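(* Let $\mathbf{G}\sim G(n,1/2)$ and let $\mu_{\mathbf{G}}$ be the hardcore model on $\mathbf{G}$ at fugacity $\lambda=1$. For an integer $k\ge 0$, let $\mu^{\mathrm{Glauber}}_k(\mathbf{G})$ be the distribution of the state of the Glauber dynamics Markov chain on $\mathbf{G}$ started from the empty set and run until the stopping time $\tau = \min\{100\,(\log n)\,2^k,\ \tau_k\}$, where $\tau_k$ is the first time the Markov chain hits an independent set of size $k$. Then for $k = \log n - 30\log\log n$, with probability $1-o_n(1)$ over $\mathbf{G}$, $$w_2\left(\mu_{\mathbf{G}},\ \mu^{\mathrm{Glauber}}_{k}(\mathbf{G})\right) = o_n(1).$$ That is, there is a deterministic sequence $\varepsilon_n\to 0$ such that $\Pr_{\mathbf{G}}\left[w_2(\mu_{\mathbf{G}},\mu^{\mathrm{Glauber}}_{k}(\mathbf{G}))\le \varepsilon_n\right]\ge 1-\varepsilon_n$ for all sufficiently large $n$.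
   Context: $\log=\log_2$. $G(n,1/2)$ is the Erdős–Rényi random graph on $[n]=\{1,\dots,n\}$ with edge probability $1/2$. The quantity $\log n - 30\log\log n$ is understood as rounded to the nearest integer, and the time bound $100(\log n)2^k$ as rounded to an integer. The hardcore model on a graph $G$ with vertex set $[n]$ at fugacity $\lambda=1$ is the uniform distribution $\mu_G$ over all independent sets of $G$ (including $\emptyset$). Distributions over subsets of $[n]$ are regarded as probability measures on $\{0,1\}^n\subset\mathbb{R}^n$ via indicator vectors. Glauber dynamics on $G$ (for $\lambda=1$) is the Markov chain $(S_t)_{t\ge0}$ on independent sets of $G$ defined as follows: given $S_{t-1}$, sample $v\in[n]$ uniformly at random; if $S_{t-1}\cup\{v\}$ is not an independent set, set $S_t=S_{t-1}$; otherwise let $S_t$ be uniformly distributed on the two options $S_{t-1}\cup\{v\}$ and $S_{t-1}\setminus\{v\}$. Here $S_0=\emptyset$. For probability measures $\mu,\nu$ on a Euclidean space with norm $\|\cdot\|$, the normalized $2$-Wasserstein distance is $$w_2(\mu,\nu) = \inf_{\pi \in C(\mu,\nu)} \sqrt{ \mathbb{E}_{(X,Y)\sim\pi} \left\| \frac{X}{\sqrt{\mathbb{E}_{X\sim\mu}\|X\|^2}} - \frac{Y}{\sqrt{\mathbb{E}_{Y\sim\nu}\|Y\|^2}} \right\|^2 },$$ where $C(\mu,\nu)$ is the set of all couplings of $\mu$ and $\nu$. *)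

theory Defs
  imports "HOL-Probability.Probability"
begin

section \<open>Random graphs and independent sets\<close>

text \<open>A simple graph on the vertex set \<open>{1..n}\<close> is given by its set of edges, each edge being a
  two-element set of vertices.\<close>

definition vertex_pairs :: "nat \<Rightarrow> nat set set" where
  "vertex_pairs n = {e. e \<subseteq> {1..n} \<and> card e = 2}"

definition erdos_renyi :: "nat \<Rightarrow> real \<Rightarrow> nat set set pmf" where
  "erdos_renyi n p =
     map_pmf (\<lambda>present. {e \<in> vertex_pairs n. present e})
       (Pi_pmf (vertex_pairs n) False (\<lambda>_. bernoulli_pmf p))"

definition independent_set :: "nat \<Rightarrow> nat set set \<Rightarrow> nat set \<Rightarrow> bool" where
  "independent_set n E S \<longleftrightarrow> S \<subseteq> {1..n} \<and> (\<forall>u\<in>S. \<forall>v\<in>S. {u, v} \<notin> E)"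

text \<open>The hardcore model at fugacity 1.\<close>

definition hardcore :: "nat \<Rightarrow> nat set set \<Rightarrow> nat set pmf" where
  "hardcore n E = pmf_of_set {S. independent_set n E S}"

section \<open>Glauber dynamics\<close>

definition glauber_step :: "nat \<Rightarrow> nat set set \<Rightarrow> nat set \<Rightarrow> nat set pmf" where
  "glauber_step n E S = do {
     v \<leftarrow> pmf_of_set {1..n};
     if independent_set n E (insert v S) then pmf_of_set {insert v S, S - {v}}
     else return_pmf S
   }"

text \<open>The law of the trajectory \<open>[S\<^sub>0, \<dots>, S\<^sub>T]\<close>, a list of length \<open>T + 1\<close>.\<close>

primrec glauber_path :: "nat \<Rightarrow> nat set set \<Rightarrow> nat \<Rightarrow> nat set list pmf" where
  "glauber_path n E 0 = return_pmf [{}]"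
| "glauber_path n E (Suc T) = do {
     Ss \<leftarrow> glauber_path n E T;
     S \<leftarrow> glauber_step n E (last Ss);
     return_pmf (Ss @ [S])
   }"

text \<open>The minimum of \<open>T\<close> and the hitting time of size \<open>k\<close>, the latter being infinite if size \<open>k\<close>
  is never hit.  Only the states at times up to \<open>T\<close> matter.\<close>

definition stopping_index :: "nat \<Rightarrow> nat \<Rightarrow> nat set list \<Rightarrow> nat" where
  "stopping_index T k Ss = (LEAST t. t = T \<or> card (Ss ! t) = k)"

definition glauber_time :: "nat \<Rightarrow> nat \<Rightarrow> nat" where
  "glauber_time n k = nat (round (100 * log 2 (real n) * 2 ^ k))"

definition glauber_stopped :: "nat \<Rightarrow> nat set set \<Rightarrow> nat \<Rightarrow> nat set pmf" where
  "glauber_stopped n E k =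
     (let T = glauber_time n k
      in map_pmf (\<lambda>Ss. Ss ! stopping_index T k Ss) (glauber_path n E T))"

section \<open>Normalized Wasserstein distance\<close>

text \<open>Since the dimension varies with \<open>n\<close>, Euclidean \<open>n\<close>-space is the product of \<open>n\<close> copies of the
  Borel line, with coordinates indexed by \<open>{1..n}\<close>; its points are extensional functions, and
  \<^term>\<open>\<lambda>x. L2_set x {1..n}\<close> is its norm.\<close>

definition euclidean_measure :: "nat \<Rightarrow> (nat \<Rightarrow> real) measure" where
  "euclidean_measure n = Pi\<^sub>M {1..n} (\<lambda>_. borel)"

definition subset_law :: "nat \<Rightarrow> nat set pmf \<Rightarrow> (nat \<Rightarrow> real) measure" where
  "subset_law n p = distr (measure_pmf p) (euclidean_measure n) (\<lambda>S. restrict (indicator S) {1..n})"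

definition couplings ::
  "nat \<Rightarrow> (nat \<Rightarrow> real) measure \<Rightarrow> (nat \<Rightarrow> real) measure
     \<Rightarrow> ((nat \<Rightarrow> real) \<times> (nat \<Rightarrow> real)) measure set" where
  "couplings n \<mu> \<nu> =
     {\<pi>. prob_space \<pi> \<and> sets \<pi> = sets (euclidean_measure n \<Otimes>\<^sub>M euclidean_measure n) \<and>
          distr \<pi> (euclidean_measure n) fst = \<mu> \<and> distr \<pi> (euclidean_measure n) snd = \<nu>}"

definition rms_norm :: "nat \<Rightarrow> (nat \<Rightarrow> real) measure \<Rightarrow> real" where
  "rms_norm n \<mu> = sqrt (\<integral>x. (L2_set x {1..n})\<^sup>2 \<partial>\<mu>)"

text \<open>Meaningful for probability measures on \<^term>\<open>euclidean_measure n\<close> with finite, nonzero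
  second moments; every coupling then makes the integrand below integrable.\<close>

definition w2 :: "nat \<Rightarrow> (nat \<Rightarrow> real) measure \<Rightarrow> (nat \<Rightarrow> real) measure \<Rightarrow> real" where
  "w2 n \<mu> \<nu> =
     (INF \<pi>\<in>couplings n \<mu> \<nu>.
        sqrt (\<integral>(x, y). (L2_set (\<lambda>i. x i / rms_norm n \<mu> - y i / rms_norm n \<nu>) {1..n})\<^sup>2 \<partial>\<pi>))"

end

theory Submission
  imports Defs "HOL-Real_Asymp.Real_Asymp"
begin

text \<open>Write \<open>I\<^sub>j\<close> for the independent sets of size \<open>j\<close>, \<open>u\<^sub>j\<close> for the uniform law on \<open>I\<^sub>j\<close>, and
  \<open>N(K)\<close> for the number of vertices extending \<open>K\<close> to a larger independent set.  Given that \<open>K\<close> is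
  independent, \<open>N(K)\<close> is binomial with mean \<open>\<nu>\<^sub>j = (n - j) / 2\<^sup>j\<close>, as it depends only on edges leaving
  \<open>K\<close>.  So the average relative deviation of \<open>N\<close> over \<open>I\<^sub>j\<close> is of order \<open>\<nu>\<^sub>j\<close> to the power \<open>-1/2\<close>, and its
  sum over all \<open>j < m\<close> tends to 0 for \<open>m = log n - (1/2) log log n\<close>.  This first-moment bound controls

  \<^item> \<open>|I\<^sub>j|\<close>, because \<open>(j + 1) |I\<^bsub>j+1\<^esub>|\<close> is the sum of \<open>N\<close> over \<open>I\<^sub>j\<close>; hence the hardcore model lives on
    sizes between \<open>k\<close> and \<open>m\<close>;
  \<^item> the distance between \<open>u\<^sub>j\<close> and the law obtained from \<open>u\<^bsub>j+1\<^esub>\<close> by removing a random element; hence a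
    sample of the hardcore model contains a nearly uniform element of \<open>I\<^sub>k\<close>;
  \<^item> the distance between \<open>u\<^bsub>j+1\<^esub>\<close> and the law obtained from \<open>u\<^sub>j\<close> by adding a random extending vertex;
    hence Glauber dynamics, which within the time bound rarely removes a vertex, arrives at a nearly
    uniform element of \<open>I\<^sub>k\<close>.

  Coupling through \<open>u\<^sub>k\<close>, the two samples share \<open>k\<close> elements, which is almost all of either since
  \<open>k / m\<close> tends to 1.\<close>

section \<open>Distance of laws on a finite set\<close>

text \<open>Twice the total variation distance whenever \<open>A\<close> carries both laws. A finite
  carrier is passed explicitly so that sums replace integrals.\<close>

definition l1_dist :: "'a set \<Rightarrow> 'a pmf \<Rightarrow> 'a pmf \<Rightarrow> real" where
  "l1_dist A p q = (\<Sum>x\<in>A. \<bar>pmf p x - pmf q x\<bar>)"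

lemma l1_dist_self [simp]: "l1_dist A p p = 0"
  by (simp add: l1_dist_def)

lemma l1_dist_commute: "l1_dist A p q = l1_dist A q p"
  by (simp add: l1_dist_def abs_minus_commute)

lemma l1_dist_triangle: "l1_dist A p r \<le> l1_dist A p q + l1_dist A q r"
  unfolding l1_dist_def sum.distrib[symmetric] by (intro sum_mono) linarith

lemma sum_pmf_le_1: "finite A \<Longrightarrow> (\<Sum>x\<in>A. pmf p x) \<le> 1"
  using measure_measure_pmf_finite[of A p] measure_pmf.prob_le_1[of p A] by simp

lemma l1_dist_le_2:
  assumes "finite A"
  shows "l1_dist A p q \<le> 2"
proof -
  have "l1_dist A p q \<le> (\<Sum>x\<in>A. pmf p x + pmf q x)"
    unfolding l1_dist_def
    by (intro sum_mono) (smt (verit) pmf_nonneg)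
  then show ?thesis
    using sum_pmf_le_1[OF assms, of p] sum_pmf_le_1[OF assms, of q] by (simp add: sum.distrib)
qed

lemma pmf_bind_finite:
  assumes "finite A" "set_pmf p \<subseteq> A"
  shows "pmf (bind_pmf p P) y = (\<Sum>x\<in>A. pmf p x * pmf (P x) y)"
  unfolding pmf_bind by (subst integral_measure_pmf[where A = A]) (use assms in auto)

text \<open>Applying a common kernel cannot separate two laws: a difference of mass at
  \<open>x\<close> is spread over \<open>B\<close> with total weight at most 1.\<close>

lemma l1_dist_bind_left:
  assumes "finite A" "finite B" "set_pmf p \<subseteq> A" "set_pmf q \<subseteq> A"
  shows "l1_dist B (bind_pmf p P) (bind_pmf q P) \<le> l1_dist A p q"
proof -
  have "l1_dist B (bind_pmf p P) (bind_pmf q P)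
      = (\<Sum>y\<in>B. \<bar>\<Sum>x\<in>A. (pmf p x - pmf q x) * pmf (P x) y\<bar>)"
    using assms by (simp add: l1_dist_def pmf_bind_finite sum_subtractf left_diff_distrib)
  also have "\<dots> \<le> (\<Sum>y\<in>B. \<Sum>x\<in>A. \<bar>pmf p x - pmf q x\<bar> * pmf (P x) y)"
    by (intro sum_mono order.trans[OF sum_abs]) (simp add: abs_mult)
  also have "\<dots> = (\<Sum>x\<in>A. \<bar>pmf p x - pmf q x\<bar> * (\<Sum>y\<in>B. pmf (P x) y))"
    by (subst sum.swap) (simp add: sum_distrib_left)
  also have "\<dots> \<le> (\<Sum>x\<in>A. \<bar>pmf p x - pmf q x\<bar> * 1)"
    by (intro sum_mono mult_left_mono sum_pmf_le_1 assms) simp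
  finally show ?thesis by (simp add: l1_dist_def)
qed

lemma l1_dist_bind_right:
  assumes "finite A" "set_pmf p \<subseteq> A"
  shows "l1_dist B (bind_pmf p P) (bind_pmf p Q) \<le> (\<Sum>x\<in>A. pmf p x * l1_dist B (P x) (Q x))"
proof -
  have "l1_dist B (bind_pmf p P) (bind_pmf p Q)
      = (\<Sum>y\<in>B. \<bar>\<Sum>x\<in>A. pmf p x * (pmf (P x) y - pmf (Q x) y)\<bar>)"
    using assms by (simp add: l1_dist_def pmf_bind_finite sum_subtractf right_diff_distrib)
  also have "\<dots> \<le> (\<Sum>y\<in>B. \<Sum>x\<in>A. pmf p x * \<bar>pmf (P x) y - pmf (Q x) y\<bar>)"
    by (intro sum_mono order.trans[OF sum_abs]) (simp add: abs_mult)
  also have "\<dots> = (\<Sum>x\<in>A. pmf p x * l1_dist B (P x) (Q x))"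
    by (subst sum.swap) (simp add: sum_distrib_left l1_dist_def)
  finally show ?thesis .
qed

text \<open>The maximal coupling, as a kernel: keep \<open>x\<close> with probability \<open>min 1 (q x / p x)\<close> and
  otherwise sample from the normalized positive part of \<open>q - p\<close>.\<close>

lemma ex_coupling_kernel_sum:
  assumes A: "finite A" "set_pmf p \<subseteq> A" "set_pmf q \<subseteq> A"
  shows "\<exists>r. bind_pmf p r = q \<and> (\<Sum>x\<in>A. pmf p x * (1 - pmf (r x) x)) \<le> l1_dist A p q"
proof (cases "p = q")
  case True
  then show ?thesis
    by (intro exI[of _ return_pmf]) (simp add: bind_return_pmf')
next
  case False
  define d where "d = (\<Sum>x\<in>A. max 0 (pmf q x - pmf p x))"
  have sum1: "(\<Sum>x\<in>A. pmf p x) = 1" "(\<Sum>x\<in>A. pmf q x) = 1"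
    using A by (auto intro: sum_pmf_eq_1)
  \<comment> \<open>Both laws have mass 1 on \<open>A\<close>, so the excess of \<open>p\<close>
    over \<open>q\<close> equals the excess of \<open>q\<close> over \<open>p\<close>: exactly the
    mass removed has to be placed again.\<close>
  have d': "(\<Sum>x\<in>A. max 0 (pmf p x - pmf q x)) = d"
  proof -
    have "(\<Sum>x\<in>A. max 0 (pmf p x - pmf q x)) - d = (\<Sum>x\<in>A. pmf p x - pmf q x)"
      unfolding d_def sum_subtractf[symmetric] by (intro sum.cong) auto
    then show ?thesis using sum1 by (simp add: sum_subtractf)
  qed
  have d_le: "d \<le> l1_dist A p q"
    unfolding d_def l1_dist_def by (intro sum_mono) auto
  \<comment> \<open>The law of the relocated mass is normalized by \<open>d\<close>; this is the
    reason for treating \<open>p = q\<close> separately.\<close>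
  have "d > 0"
  proof (rule ccontr)
    assume "\<not> d > 0"
    moreover have "d \<ge> 0" unfolding d_def by (intro sum_nonneg) auto
    ultimately have "d = 0" by simp
    then have "\<forall>x\<in>A. max 0 (pmf q x - pmf p x) = 0"
      using A(1) unfolding d_def by (subst (asm) sum_nonneg_eq_0_iff) auto
    moreover have "\<forall>x\<in>A. max 0 (pmf p x - pmf q x) = 0"
      using sum_nonneg_eq_0_iff[OF A(1), of "\<lambda>x. max 0 (pmf p x - pmf q x)"] d' \<open>d = 0\<close> by simp
    ultimately have "pmf p x = pmf q x" if "x \<in> A" for x
      using that by (smt (verit) max_def)
    moreover have "pmf p x = pmf q x" if "x \<notin> A" for x
      using that A by (metis pmf_eq_0_set_pmf subsetD)
    ultimately have "pmf p x = pmf q x" for x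
      by blast
    then show False using False by (simp add: pmf_eqI)
  qed
  define f where "f x = (if x \<in> A then max 0 (pmf q x - pmf p x) / d else 0)" for x
  define \<rho> where "\<rho> = embed_pmf f"
  have "(\<integral>\<^sup>+ x. ennreal (f x) \<partial>count_space UNIV) = (\<Sum>x\<in>A. ennreal (f x))"
    by (rule nn_integral_count_space'[OF A(1)]) (auto simp: f_def)
  also have "\<dots> = ennreal (\<Sum>x\<in>A. f x)"
    using \<open>d > 0\<close> by (subst sum_ennreal) (auto simp: f_def)
  also have "(\<Sum>x\<in>A. f x) = (\<Sum>x\<in>A. max 0 (pmf q x - pmf p x)) / d"
    unfolding sum_divide_distrib by (intro sum.cong) (auto simp: f_def)
  also have "\<dots> = 1" using \<open>d > 0\<close> by (simp add: d_def)
  finally have \<rho>: "pmf \<rho> x = f x" for x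
    unfolding \<rho>_def using \<open>d > 0\<close> by (intro pmf_embed_pmf) (auto simp: f_def)
  \<comment> \<open>Where \<open>pmf p x = 0\<close> the quotient is 0 by convention. This is
    harmless, because the identity \<open>p\<alpha>\<close> holds there as well.\<close>
  define \<alpha> where "\<alpha> x = min 1 (pmf q x / pmf p x)" for x
  have \<alpha>: "0 \<le> \<alpha> x" "\<alpha> x \<le> 1" for x by (auto simp: \<alpha>_def)
  have p\<alpha>: "pmf p x * \<alpha> x = min (pmf p x) (pmf q x)" for x
    by (cases "pmf p x = 0") (auto simp: \<alpha>_def min_def field_simps pos_le_divide_eq less_le)
  define r where "r x = bernoulli_pmf (\<alpha> x) \<bind> (\<lambda>b. if b then return_pmf x else \<rho>)" for x
  have pmf_r: "pmf (r x) y = \<alpha> x * indicator {x} y + (1 - \<alpha> x) * f y" for x y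
    by (simp add: r_def pmf_bind \<alpha> \<rho> indicator_def)
  have "bind_pmf p r = q"
  proof (rule pmf_eqI)
    fix y
    have "pmf (bind_pmf p r) y = (\<Sum>x\<in>A. pmf p x * \<alpha> x * indicator {x} y + (pmf p x - pmf p x * \<alpha> x) * f y)"
      using A by (simp add: pmf_bind_finite pmf_r algebra_simps)
    also have "\<dots> = (\<Sum>x\<in>A. pmf p x * \<alpha> x * indicator {x} y) + (\<Sum>x\<in>A. pmf p x - pmf p x * \<alpha> x) * f y"
      by (simp only: sum.distrib sum_distrib_right)
    also have "(\<Sum>x\<in>A. pmf p x - pmf p x * \<alpha> x) = (\<Sum>x\<in>A. max 0 (pmf p x - pmf q x))"
      by (intro sum.cong) (auto simp: p\<alpha>)
    also have "\<dots> = d" by (rule d')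
    also have "(\<Sum>x\<in>A. pmf p x * \<alpha> x * indicator {x} y) = (if y \<in> A then min (pmf p y) (pmf q y) else 0)"
      using A(1) by (simp add: p\<alpha> indicator_def if_distrib cong: if_cong)
    also have "\<dots> + d * f y = pmf q y"
      using A \<open>d > 0\<close> by (auto simp: f_def set_pmf_iff)
    finally show "pmf (bind_pmf p r) y = pmf q y" .
  qed
  moreover have "(\<Sum>x\<in>A. pmf p x * (1 - pmf (r x) x)) \<le> (\<Sum>x\<in>A. max 0 (pmf p x - pmf q x))"
  proof (rule sum_mono)
    fix x
    have "\<alpha> x \<le> pmf (r x) x"
      using \<alpha>[of x] \<open>d > 0\<close> by (simp add: pmf_r f_def)
    then have "pmf p x * (1 - pmf (r x) x) \<le> pmf p x * (1 - \<alpha> x)"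
      by (intro mult_left_mono) auto
    also have "\<dots> = max 0 (pmf p x - pmf q x)"
      using p\<alpha>[of x] by (auto simp: right_diff_distrib)
    finally show "pmf p x * (1 - pmf (r x) x) \<le> max 0 (pmf p x - pmf q x)" .
  qed
  ultimately show ?thesis
    using d' d_le by (intro exI[of _ r]) auto
qed

text \<open>The moved mass read as the probability that the coupled pair disagrees. A kernel, rather
  than a joint law, can be appended to any sample whose last component has law \<open>p\<close>,
  which is how couplings are glued later.\<close>

lemma ex_coupling_kernel:
  assumes A: "finite A" "set_pmf p \<subseteq> A" "set_pmf q \<subseteq> A"
  shows "\<exists>r. bind_pmf p r = q \<and>
    measure_pmf.prob (bind_pmf p (\<lambda>x. map_pmf (Pair x) (r x))) {(x, y). x \<noteq> y} \<le> l1_dist A p q"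
proof -
  obtain r where r: "bind_pmf p r = q" "(\<Sum>x\<in>A. pmf p x * (1 - pmf (r x) x)) \<le> l1_dist A p q"
    using ex_coupling_kernel_sum[OF A] by blast
  let ?c = "bind_pmf p (\<lambda>x. map_pmf (Pair x) (r x))"
  have eq: "(\<lambda>y. x = y) -` {True} = {x}" for x :: 'a by auto
  have "measure_pmf.prob ?c {(x, y). x = y} = pmf (map_pmf (\<lambda>(x, y). x = y) ?c) True"
    unfolding pmf_map by (rule arg_cong[where f = "measure_pmf.prob ?c"]) auto
  also have "map_pmf (\<lambda>(x, y). x = y) ?c = bind_pmf p (\<lambda>x. map_pmf (\<lambda>y. x = y) (r x))"
    by (simp add: map_bind_pmf pmf.map_comp comp_def)
  also have "pmf \<dots> True = (\<Sum>x\<in>A. pmf p x * pmf (r x) x)"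
    by (subst pmf_bind_finite[OF A(1,2)]) (simp add: pmf_map eq measure_pmf_single)
  finally have "measure_pmf.prob ?c {(x, y). x = y} = (\<Sum>x\<in>A. pmf p x * pmf (r x) x)" .
  moreover have "measure_pmf.prob ?c {(x, y). x \<noteq> y} = 1 - measure_pmf.prob ?c {(x, y). x = y}"
    by (subst measure_pmf.prob_compl[symmetric]) (auto intro: arg_cong[where f = "measure_pmf.prob ?c"])
  moreover have "(\<Sum>x\<in>A. pmf p x) = 1"
    by (rule sum_pmf_eq_1[OF A(1,2)])
  ultimately show ?thesis
    using r by (intro exI[of _ r]) (simp add: right_diff_distrib sum_subtractf)
qed

section \<open>Wasserstein distance of random sets\<close>

lemma sum_indicator_subset:
  "finite A \<Longrightarrow> S \<subseteq> A \<Longrightarrow> (\<Sum>i\<in>A. indicat_real S i) = real (card S)"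
  by (simp add: indicator_def sum.If_cases Int_absorb1 Collect_conj_eq)

text \<open>Expand the square coordinatewise: indicators are idempotent, and a product of two is the
  indicator of the intersection.\<close>

lemma L2_set_restrict_indicator:
  fixes a b :: real and n :: nat
  assumes "S \<subseteq> {1..n}" "Y \<subseteq> {1..n}"
  shows "(L2_set (\<lambda>i. restrict (indicator S) {1..n} i / a - restrict (indicator Y) {1..n} i / b) {1..n})\<^sup>2
     = real (card S) / a\<^sup>2 + real (card Y) / b\<^sup>2 - 2 * real (card (S \<inter> Y)) / (a * b)"
proof -
  have "(L2_set (\<lambda>i. restrict (indicator S) {1..n} i / a - restrict (indicator Y) {1..n} i / b) {1..n})\<^sup>2
     = (\<Sum>i=1..n. (indicator S i / a - indicator Y i / b)\<^sup>2)"
    unfolding L2_set_def by (subst real_sqrt_pow2) (auto intro: sum_nonneg)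
  also have "\<dots> = (\<Sum>i=1..n. indicator S i / a\<^sup>2 + indicator Y i / b\<^sup>2 - 2 * (indicator (S \<inter> Y) i / (a * b)))"
    by (intro sum.cong) (auto simp: indicator_def power2_diff power_divide)
  also have "\<dots> = (\<Sum>i=1..n. indicator S i) / a\<^sup>2 + (\<Sum>i=1..n. indicator Y i) / b\<^sup>2
       - 2 * ((\<Sum>i=1..n. indicator (S \<inter> Y) i) / (a * b))"
    by (simp only: sum_subtractf sum.distrib sum_divide_distrib sum_distrib_left)
  finally show ?thesis
    by (simp add: sum_indicator_subset[OF _ assms(1)] sum_indicator_subset[OF _ assms(2)]
        sum_indicator_subset[OF _ le_infI1[OF assms(1)]] del: One_nat_def)
qed

lemma L2_set_restrict_indicator_self:
  fixes n :: nat
  assumes "S \<subseteq> {1..n}"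
  shows "(L2_set (restrict (indicator S) {1..n}) {1..n})\<^sup>2 = real (card S)"
proof -
  have "(L2_set (restrict (indicator S) {1..n}) {1..n})\<^sup>2 = (\<Sum>i=1..n. (restrict (indicator S) {1..n} i)\<^sup>2)"
    unfolding L2_set_def by (rule real_sqrt_pow2) (rule sum_nonneg, simp)
  also have "\<dots> = (\<Sum>i=1..n. indicator S i)"
    by (intro sum.cong) (auto simp: indicator_def)
  finally have "(L2_set (restrict (indicator S) {1..n}) {1..n})\<^sup>2 = (\<Sum>i=1..n. indicator S i)" .
  then show ?thesis
    by (simp add: sum_indicator_subset[OF _ assms] del: One_nat_def)
qed

lemma restrict_in_space_euclidean [simp]: "restrict f {1..n} \<in> space (euclidean_measure n)"
  unfolding euclidean_measure_def by (auto simp: space_PiM)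

lemma measurable_L2_set_euclidean [measurable]:
  "(\<lambda>x. L2_set x {1..n}) \<in> borel_measurable (euclidean_measure n)"
  unfolding L2_set_def euclidean_measure_def by measurable

lemma rms_norm_subset_law:
  assumes "set_pmf p \<subseteq> Pow {1..n}"
  shows "rms_norm n (subset_law n p) = sqrt (measure_pmf.expectation p (\<lambda>S. real (card S)))"
proof -
  have "(\<integral>x. (L2_set x {1..n})\<^sup>2 \<partial>subset_law n p)
     = measure_pmf.expectation p (\<lambda>S. (L2_set (restrict (indicator S) {1..n}) {1..n})\<^sup>2)"
    unfolding subset_law_def by (rule integral_distr) (auto simp del: One_nat_def)
  also have "\<dots> = measure_pmf.expectation p (\<lambda>S. real (card S))"
  proof (rule integral_cong_AE)
    show "AE S in measure_pmf p. (L2_set (restrict (indicator S) {1..n}) {1..n})\<^sup>2 = real (card S)"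
      using assms by (intro AE_pmfI L2_set_restrict_indicator_self) auto
  qed auto
  finally show ?thesis by (simp add: rms_norm_def)
qed

text \<open>After normalization both laws have second moment 1, so the cost of a coupling depends
  only on its expected overlap. An upper bound on the distance thus becomes a lower bound on the
  expected size of the intersection.\<close>

lemma w2_le_coupling:
  fixes c :: "(nat set \<times> nat set) pmf"
  defines "p \<equiv> map_pmf fst c" and "q \<equiv> map_pmf snd c"
  assumes supp: "set_pmf p \<subseteq> Pow {1..n}" "set_pmf q \<subseteq> Pow {1..n}"
  assumes pos: "measure_pmf.expectation p (\<lambda>S. real (card S)) > 0"
      "measure_pmf.expectation q (\<lambda>S. real (card S)) > 0"
  shows "w2 n (subset_law n p) (subset_law n q)
    \<le> sqrt (2 - 2 * measure_pmf.expectation c (\<lambda>(S, Y). real (card (S \<inter> Y))) /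
         (sqrt (measure_pmf.expectation p (\<lambda>S. real (card S))) *
          sqrt (measure_pmf.expectation q (\<lambda>S. real (card S)))))"
proof -
  let ?\<mu> = "subset_law n p" and ?\<nu> = "subset_law n q"
  let ?E = "euclidean_measure n"
  let ?ind = "\<lambda>S. restrict (indicator S) {1..n} :: nat \<Rightarrow> real"
  define a where "a = rms_norm n ?\<mu>"
  define b where "b = rms_norm n ?\<nu>"
  have a: "a = sqrt (measure_pmf.expectation p (\<lambda>S. real (card S)))"
    unfolding a_def by (rule rms_norm_subset_law[OF supp(1)])
  have b: "b = sqrt (measure_pmf.expectation q (\<lambda>S. real (card S)))"
    unfolding b_def by (rule rms_norm_subset_law[OF supp(2)])
  have c: "set_pmf c \<subseteq> Pow {1..n} \<times> Pow {1..n}"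
  proof (rule subsetI)
    fix x assume "x \<in> set_pmf c"
    then have "fst x \<in> set_pmf p" "snd x \<in> set_pmf q"
      by (simp_all add: p_def q_def)
    then show "x \<in> Pow {1..n} \<times> Pow {1..n}"
      using supp by (cases x) (simp add: subset_iff)
  qed
  have finc: "finite (set_pmf c)" by (rule finite_subset[OF c]) auto
  \<comment> \<open>The coupling of random sets is transported to Euclidean space by taking
    indicator vectors in both components.\<close>
  define \<pi> where "\<pi> = distr (measure_pmf c) (?E \<Otimes>\<^sub>M ?E) (\<lambda>(S, Y). (?ind S, ?ind Y))"
  have m [measurable]: "(\<lambda>(S, Y). (?ind S, ?ind Y)) \<in> measurable (measure_pmf c) (?E \<Otimes>\<^sub>M ?E)"
    by (auto simp: space_pair_measure simp del: One_nat_def)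
  have cost [measurable]: "(\<lambda>(x, y). (L2_set (\<lambda>i. x i / a - y i / b) {1..n})\<^sup>2) \<in> borel_measurable (?E \<Otimes>\<^sub>M ?E)"
    unfolding euclidean_measure_def L2_set_def by measurable
  have "\<pi> \<in> couplings n ?\<mu> ?\<nu>"
  proof -
    have "prob_space \<pi>"
      unfolding \<pi>_def by (rule measure_pmf.prob_space_distr[OF m])
    moreover have "distr \<pi> ?E fst = ?\<mu>"
      unfolding \<pi>_def subset_law_def p_def map_pmf_rep_eq
      by (simp add: distr_distr[OF measurable_fst m] distr_distr comp_def case_prod_beta del: One_nat_def)
    moreover have "distr \<pi> ?E snd = ?\<nu>"
      unfolding \<pi>_def subset_law_def q_def map_pmf_rep_eq
      by (simp add: distr_distr[OF measurable_snd m] distr_distr comp_def case_prod_beta del: One_nat_def)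
    ultimately show ?thesis
      by (simp add: couplings_def \<pi>_def)
  qed
  then have "w2 n ?\<mu> ?\<nu> \<le> sqrt (\<integral>(x, y). (L2_set (\<lambda>i. x i / a - y i / b) {1..n})\<^sup>2 \<partial>\<pi>)"
    unfolding w2_def a_def b_def
    by (intro cINF_lower) (auto intro!: bdd_belowI[of _ 0] Bochner_Integration.integral_nonneg simp: case_prod_beta)
  also have "(\<integral>(x, y). (L2_set (\<lambda>i. x i / a - y i / b) {1..n})\<^sup>2 \<partial>\<pi>)
      = measure_pmf.expectation c (\<lambda>(S, Y). (L2_set (\<lambda>i. ?ind S i / a - ?ind Y i / b) {1..n})\<^sup>2)"
    unfolding \<pi>_def by (subst integral_distr[OF m cost]) (simp add: case_prod_unfold del: restrict_apply)
  also have "\<dots> = measure_pmf.expectation c (\<lambda>(S, Y). real (card S) / a\<^sup>2 + real (card Y) / b\<^sup>2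
        - 2 * real (card (S \<inter> Y)) / (a * b))"
    using c by (intro integral_cong_AE) (auto simp: AE_measure_pmf_iff L2_set_restrict_indicator simp del: restrict_apply One_nat_def)
  also have "\<dots> = measure_pmf.expectation c (\<lambda>x. real (card (fst x))) / a\<^sup>2
      + measure_pmf.expectation c (\<lambda>x. real (card (snd x))) / b\<^sup>2
      - 2 * measure_pmf.expectation c (\<lambda>x. real (card (fst x \<inter> snd x))) / (a * b)"
    by (simp add: case_prod_unfold integrable_measure_pmf_finite[OF finc])
  also have "measure_pmf.expectation c (\<lambda>x. real (card (fst x))) = a\<^sup>2"
    using pos(1) by (simp add: a p_def)
  also have "measure_pmf.expectation c (\<lambda>x. real (card (snd x))) = b\<^sup>2"
    using pos(2) by (simp add: b q_def)
  finally show ?thesis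
    using pos by (simp add: a b case_prod_unfold)
qed

section \<open>Counting independent sets by extensions\<close>

definition indep_sets :: "nat \<Rightarrow> nat set set \<Rightarrow> nat \<Rightarrow> nat set set" where
  "indep_sets n E j = {S. independent_set n E S \<and> card S = j}"

definition num_indep :: "nat \<Rightarrow> nat set set \<Rightarrow> nat \<Rightarrow> nat" where
  "num_indep n E j = card (indep_sets n E j)"

definition extensions :: "nat \<Rightarrow> nat set set \<Rightarrow> nat set \<Rightarrow> nat set" where
  "extensions n E S = {v \<in> {1..n} - S. independent_set n E (insert v S)}"

lemma independent_set_subset: "independent_set n E S \<Longrightarrow> S \<subseteq> {1..n}"
  by (simp add: independent_set_def)

lemma finite_independent_set: "independent_set n E S \<Longrightarrow> finite S"
  by (rule finite_subset[OF independent_set_subset]) simp_all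

lemma independent_set_mono: "independent_set n E S \<Longrightarrow> T \<subseteq> S \<Longrightarrow> independent_set n E T"
  unfolding independent_set_def by blast

lemma independent_set_empty [simp]: "independent_set n E {}"
  by (simp add: independent_set_def)

lemma finite_independent_sets [simp]: "finite {S. independent_set n E S}"
  by (rule finite_subset[of _ "Pow {1..n}"]) (auto simp: independent_set_def)

lemma finite_indep_sets [simp]: "finite (indep_sets n E j)"
  unfolding indep_sets_def by (rule finite_subset[OF _ finite_independent_sets]) auto

lemma indep_sets_subset_Pow: "indep_sets n E j \<subseteq> Pow {1..n}"
  by (auto simp: indep_sets_def independent_set_def)

lemma finite_extensions [simp]: "finite (extensions n E S)"
  by (simp add: extensions_def)

lemma card_extensions_le: "card (extensions n E S) \<le> n"
proof -
  have "extensions n E S \<subseteq> {1..n}" by (auto simp: extensions_def)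
  from card_mono[OF _ this] show ?thesis by simp
qed

lemma indep_sets_0 [simp]: "indep_sets n E 0 = {{}}"
  by (auto simp: indep_sets_def dest: finite_independent_set)

lemma num_indep_0 [simp]: "num_indep n E 0 = 1"
  by (simp add: num_indep_def)

lemma indep_sets_Suc_remove:
  "L \<in> indep_sets n E (Suc j) \<Longrightarrow> v \<in> L \<Longrightarrow> L - {v} \<in> indep_sets n E j"
  using independent_set_mono[of n E L "L - {v}"] finite_independent_set[of n E L]
  by (auto simp: indep_sets_def)

lemma indep_sets_insert:
  "K \<in> indep_sets n E j \<Longrightarrow> v \<in> extensions n E K \<Longrightarrow> insert v K \<in> indep_sets n E (Suc j)"
  by (auto simp: indep_sets_def extensions_def dest: finite_independent_set)

lemma mem_extensions:
  assumes "L \<in> indep_sets n E (Suc j)" "v \<in> L"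
  shows "v \<in> extensions n E (L - {v})"
proof -
  have "independent_set n E L" using assms(1) by (simp add: indep_sets_def)
  then have "v \<in> {1..n}" using assms(2) by (auto simp: independent_set_def)
  then show ?thesis
    using \<open>independent_set n E L\<close> assms(2) by (simp add: extensions_def insert_absorb)
qed

text \<open>Double counting: a set of size \<open>j\<close> with an extending vertex is the same as
  a set of size \<open>j + 1\<close> with a marked element, by adding or removing that
  vertex.\<close>

lemma sum_card_extensions:
  "(\<Sum>K\<in>indep_sets n E j. card (extensions n E K)) = Suc j * num_indep n E (Suc j)"
proof -
  have "(\<Sum>K\<in>indep_sets n E j. card (extensions n E K))
      = card (SIGMA K:indep_sets n E j. extensions n E K)"
    by simp
  also have "\<dots> = card (SIGMA L:indep_sets n E (Suc j). L)"
  proof (rule bij_betw_same_card)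
    show "bij_betw (\<lambda>(K, v). (insert v K, v)) (SIGMA K:indep_sets n E j. extensions n E K)
        (SIGMA L:indep_sets n E (Suc j). L)"
    proof (rule bij_betwI[where g = "\<lambda>(L, v). (L - {v}, v)"])
      show "(\<lambda>(L, v). (L - {v}, v)) \<in> (SIGMA L:indep_sets n E (Suc j). L)
          \<rightarrow> (SIGMA K:indep_sets n E j. extensions n E K)"
        by (auto intro: indep_sets_Suc_remove mem_extensions)
    qed (auto simp: indep_sets_insert insert_absorb, auto simp: extensions_def)
  qed
  also have "\<dots> = (\<Sum>L\<in>indep_sets n E (Suc j). card L)"
    by (intro card_SigmaI) (auto simp: indep_sets_def intro: finite_independent_set)
  also have "\<dots> = (\<Sum>L\<in>indep_sets n E (Suc j). Suc j)"
    by (intro sum.cong) (auto simp: indep_sets_def)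
  finally show ?thesis by (simp add: num_indep_def)
qed

text \<open>The pairs counted are \<open>(L - {v}, v)\<close> for \<open>v\<close> in
  \<open>L\<close>. Their number does not depend on \<open>L\<close>, so growing from a uniform set
  treats all sets of size \<open>j + 1\<close> alike.\<close>

lemma card_extensions_inserting:
  assumes L: "L \<in> indep_sets n E (Suc j)"
  shows "(\<Sum>K\<in>indep_sets n E j. card {v \<in> extensions n E K. insert v K = L}) = Suc j"
proof -
  have "(\<Sum>K\<in>indep_sets n E j. card {v \<in> extensions n E K. insert v K = L})
      = card (SIGMA K:indep_sets n E j. {v \<in> extensions n E K. insert v K = L})"
    by simp
  also have "\<dots> = card L"
  proof (rule bij_betw_same_card)
    show "bij_betw snd (SIGMA K:indep_sets n E j. {v \<in> extensions n E K. insert v K = L}) L"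
    proof (rule bij_betwI[where g = "\<lambda>v. (L - {v}, v)"])
      show "(\<lambda>v. (L - {v}, v)) \<in> L \<rightarrow> (SIGMA K:indep_sets n E j. {v \<in> extensions n E K. insert v K = L})"
        using L by (auto intro: indep_sets_Suc_remove mem_extensions)
    qed (auto, auto simp: extensions_def)
  qed
  finally show ?thesis using L by (simp add: indep_sets_def)
qed

text \<open>Each extending vertex \<open>v\<close> of \<open>K\<close> comes from the single set
  \<open>insert v K\<close>. Hence removing a random element from a uniform set reaches
  \<open>K\<close> with weight proportional to its number of extensions.\<close>

lemma card_removing:
  assumes K: "K \<in> indep_sets n E j"
  shows "(\<Sum>L\<in>indep_sets n E (Suc j). card {v \<in> L. L - {v} = K}) = card (extensions n E K)"
proof -
  have "(\<Sum>L\<in>indep_sets n E (Suc j). card {v \<in> L. L - {v} = K})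
      = card (SIGMA L:indep_sets n E (Suc j). {v \<in> L. L - {v} = K})"
    by (intro card_SigmaI[symmetric]) (auto simp: indep_sets_def dest!: finite_independent_set)
  also have "\<dots> = card (extensions n E K)"
  proof (rule bij_betw_same_card)
    show "bij_betw snd (SIGMA L:indep_sets n E (Suc j). {v \<in> L. L - {v} = K}) (extensions n E K)"
    proof (rule bij_betwI[where g = "\<lambda>v. (insert v K, v)"])
      show "(\<lambda>v. (insert v K, v)) \<in> extensions n E K \<rightarrow> (SIGMA L:indep_sets n E (Suc j). {v \<in> L. L - {v} = K})"
        using K by (auto intro: indep_sets_insert) (auto simp: extensions_def)
    qed (auto intro: mem_extensions)
  qed
  finally show ?thesis .
qed

section \<open>Uniform laws on levels and removal of random elements\<close>

definition unif_indep :: "nat \<Rightarrow> nat set set \<Rightarrow> nat \<Rightarrow> nat set pmf" where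
  "unif_indep n E j = pmf_of_set (indep_sets n E j)"

text \<open>By \<open>sum_card_extensions\<close> this is the average number of extensions over the
  independent sets of size \<open>j\<close> in the given graph, in contrast to the deterministic
  \<open>ext_mean\<close>.\<close>

definition mean_ext :: "nat \<Rightarrow> nat set set \<Rightarrow> nat \<Rightarrow> real" where
  "mean_ext n E j = real (Suc j * num_indep n E (Suc j)) / real (num_indep n E j)"

text \<open>The denominator is the sum of all extension counts, so this is the l1 distance between
  the uniform law on size \<open>j\<close> and the law weighted by the number of extensions.\<close>

definition irregularity :: "nat \<Rightarrow> nat set set \<Rightarrow> nat \<Rightarrow> real" where
  "irregularity n E j =
     (\<Sum>K\<in>indep_sets n E j. \<bar>real (card (extensions n E K)) - mean_ext n E j\<bar>)
       / real (Suc j * num_indep n E (Suc j))"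

lemma irregularity_nonneg: "0 \<le> irregularity n E j"
  by (simp add: irregularity_def sum_nonneg)

lemma indep_sets_nonempty: "0 < num_indep n E j \<Longrightarrow> indep_sets n E j \<noteq> {}"
  by (auto simp: num_indep_def)

lemma set_pmf_unif_indep: "0 < num_indep n E j \<Longrightarrow> set_pmf (unif_indep n E j) = indep_sets n E j"
  by (simp add: unif_indep_def indep_sets_nonempty)

lemma pmf_unif_indep:
  "0 < num_indep n E j \<Longrightarrow> pmf (unif_indep n E j) K = indicator (indep_sets n E j) K / num_indep n E j"
  by (simp add: unif_indep_def indep_sets_nonempty num_indep_def)

text \<open>Sets of size at most \<open>k\<close> are left alone, so that the step can be iterated a
  fixed number of times on sets of varying size.\<close>

definition remove_step :: "nat \<Rightarrow> nat set \<Rightarrow> nat set pmf" where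
  "remove_step k S = (if card S > k then map_pmf (\<lambda>v. S - {v}) (pmf_of_set S) else return_pmf S)"

text \<open>By \<open>card_removing\<close> the law after removal is the one weighted by extension
  counts, and \<open>irregularity\<close> measures exactly its distance from uniform.\<close>

lemma l1_dist_remove_step:
  assumes "k \<le> j" "0 < num_indep n E j" "0 < num_indep n E (Suc j)"
  shows "l1_dist (Pow {1..n}) (bind_pmf (unif_indep n E (Suc j)) (remove_step k)) (unif_indep n E j)
    = irregularity n E j"
proof -
  let ?I = "indep_sets n E" and ?z = "num_indep n E"
  let ?p = "bind_pmf (unif_indep n E (Suc j)) (remove_step k)"
  have rm: "pmf (remove_step k L) K = real (card {v \<in> L. L - {v} = K}) / real (Suc j)"
    if "L \<in> ?I (Suc j)" for L K
  proof -
    have L: "finite L" "card L = Suc j"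
      using that by (auto simp: indep_sets_def finite_independent_set)
    then have "L \<noteq> {}" by auto
    moreover have "L \<inter> (\<lambda>v. L - {v}) -` {K} = {v \<in> L. L - {v} = K}" by auto
    ultimately show ?thesis
      using L assms(1) by (simp add: remove_step_def pmf_map measure_pmf_of_set del: of_nat_Suc)
  qed
  have p: "pmf ?p K = (\<Sum>L\<in>?I (Suc j). real (card {v \<in> L. L - {v} = K})) / real (Suc j * ?z (Suc j))" for K
  proof -
    have "pmf ?p K = (\<Sum>L\<in>?I (Suc j). pmf (unif_indep n E (Suc j)) L * pmf (remove_step k L) K)"
      using assms by (intro pmf_bind_finite) (auto simp: set_pmf_unif_indep)
    also have "\<dots> = (\<Sum>L\<in>?I (Suc j). real (card {v \<in> L. L - {v} = K}) / real (Suc j * ?z (Suc j)))"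
      using assms by (intro sum.cong) (auto simp: pmf_unif_indep rm mult.commute simp del: of_nat_Suc mult_Suc)
    finally show ?thesis by (simp add: sum_divide_distrib)
  qed
  have p1: "pmf ?p K = real (card (extensions n E K)) / real (Suc j * ?z (Suc j))" if "K \<in> ?I j" for K
    using card_removing[OF that] by (simp add: p flip: of_nat_sum)
  have p0: "pmf ?p K = 0" if "K \<notin> ?I j" for K
  proof -
    have "{v \<in> L. L - {v} = K} = {}" if "L \<in> ?I (Suc j)" for L
      using indep_sets_Suc_remove[OF that] \<open>K \<notin> ?I j\<close> by auto
    then have "(\<Sum>L\<in>?I (Suc j). real (card {v \<in> L. L - {v} = K})) = 0"
      by (intro sum.neutral ballI) (simp only: card.empty of_nat_0)
    then show ?thesis by (simp only: p div_0)
  qed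
  have "l1_dist (Pow {1..n}) ?p (unif_indep n E j) = (\<Sum>K\<in>?I j. \<bar>pmf ?p K - pmf (unif_indep n E j) K\<bar>)"
    unfolding l1_dist_def
    by (rule sum.mono_neutral_right) (use assms indep_sets_subset_Pow in \<open>auto simp: p0 pmf_unif_indep\<close>)
  also have "\<dots> = (\<Sum>K\<in>?I j. \<bar>real (card (extensions n E K)) - mean_ext n E j\<bar> / real (Suc j * ?z (Suc j)))"
  proof (intro sum.cong refl)
    fix K assume K: "K \<in> ?I j"
    \<comment> \<open>The uniform weight is brought to the denominator of the removal law; its
      numerator is then the average extension count.\<close>
    have "1 / real (?z j) = mean_ext n E j / real (Suc j * ?z (Suc j))"
      using assms by (simp add: mean_ext_def del: of_nat_Suc mult_Suc)
    then have "pmf ?p K - pmf (unif_indep n E j) K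
        = (real (card (extensions n E K)) - mean_ext n E j) / real (Suc j * ?z (Suc j))"
      using K assms by (simp add: p1 pmf_unif_indep diff_divide_distrib del: of_nat_Suc of_nat_mult)
    then show "\<bar>pmf ?p K - pmf (unif_indep n E j) K\<bar>
        = \<bar>real (card (extensions n E K)) - mean_ext n E j\<bar> / real (Suc j * ?z (Suc j))"
      by (simp only: abs_divide abs_of_nat)
  qed
  finally show ?thesis by (simp add: irregularity_def sum_divide_distrib)
qed

text \<open>The number of rounds only has to exceed the surplus: with \<open>t = n\<close>, every
  subset of \<open>{1..n}\<close> of size at least \<open>k\<close> ends with exactly
  \<open>k\<close> elements.\<close>

primrec shrink :: "nat \<Rightarrow> nat \<Rightarrow> nat set \<Rightarrow> nat set pmf" where
  "shrink k 0 S = return_pmf S"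
| "shrink k (Suc t) S = bind_pmf (remove_step k S) (shrink k t)"

lemma set_pmf_shrink:
  assumes "finite S" "K \<in> set_pmf (shrink k t S)"
  shows "K \<subseteq> S \<and> (k \<le> card S \<and> card S \<le> k + t \<longrightarrow> card K = k)"
  using assms
proof (induction t arbitrary: S)
  case (Suc t)
  then obtain S' where S': "S' \<in> set_pmf (remove_step k S)" "K \<in> set_pmf (shrink k t S')" by auto
  show ?case
  proof (cases "card S > k")
    case True
    with Suc.prems(1) have "S \<noteq> {}" by auto
    with True S'(1) Suc.prems(1) obtain v where v: "v \<in> S" "S' = S - {v}"
      by (auto simp: remove_step_def)
    then have "finite S'" "card S' = card S - 1" using Suc.prems(1) by auto
    with Suc.IH[OF _ S'(2)] v True show ?thesis by auto
  next
    case False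
    with S'(1) have "S' = S" by (simp add: remove_step_def)
    with Suc.IH[OF Suc.prems(1)] S'(2) False show ?thesis by auto
  qed
qed auto

lemma shrink_eq: "card S = k \<Longrightarrow> shrink k t S = return_pmf S"
  by (induction t) (auto simp: remove_step_def bind_return_pmf)

text \<open>Each removal costs the irregularity of the level it arrives at, and the remaining
  removals are a common kernel and do not enlarge that error.\<close>

lemma l1_dist_shrink:
  assumes "k \<le> s" "s \<le> k + t" "\<And>j. j \<le> s \<Longrightarrow> 0 < num_indep n E j"
  shows "l1_dist (Pow {1..n}) (bind_pmf (unif_indep n E s) (shrink k t)) (unif_indep n E k)
    \<le> (\<Sum>j=k..<s. irregularity n E j)"
  using assms
proof (induction t arbitrary: s)
  case 0
  then have "s = k" by simp
  then show ?case by (simp add: bind_return_pmf' shrink.simps[abs_def])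
next
  case (Suc t)
  show ?case
  proof (cases "s = k")
    case True
    have "bind_pmf (unif_indep n E k) (shrink k (Suc t)) = bind_pmf (unif_indep n E k) return_pmf"
      using Suc.prems True
      by (intro bind_pmf_cong refl shrink_eq) (auto simp: set_pmf_unif_indep indep_sets_def)
    then show ?thesis using True by (simp add: bind_return_pmf' del: shrink.simps)
  next
    case False
    with Suc.prems(1) obtain j where s: "s = Suc j" "k \<le> j" by (cases s) auto
    let ?P = "Pow {1..n}"
    let ?p = "bind_pmf (unif_indep n E s) (remove_step k)"
    have supp: "set_pmf ?p \<subseteq> ?P"
    proof
      fix K assume "K \<in> set_pmf ?p"
      then obtain S where S: "S \<in> indep_sets n E s" "K \<in> set_pmf (remove_step k S)"
        using Suc.prems by (auto simp: set_pmf_unif_indep)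
      have "finite S" using S by (auto simp: indep_sets_def intro: finite_independent_set)
      then have "K \<subseteq> S" using set_pmf_shrink[of S K k 1] S(2) by (simp add: bind_return_pmf' shrink.simps[abs_def])
      then show "K \<in> ?P" using S indep_sets_subset_Pow by blast
    qed
    have "bind_pmf (unif_indep n E s) (shrink k (Suc t)) = bind_pmf ?p (shrink k t)"
      by (simp add: bind_assoc_pmf shrink.simps(2)[abs_def])
    then have "l1_dist ?P (bind_pmf (unif_indep n E s) (shrink k (Suc t))) (unif_indep n E k)
      \<le> l1_dist ?P (bind_pmf ?p (shrink k t)) (bind_pmf (unif_indep n E j) (shrink k t))
        + l1_dist ?P (bind_pmf (unif_indep n E j) (shrink k t)) (unif_indep n E k)"
      by (simp add: l1_dist_triangle)
    also have "\<dots> \<le> l1_dist ?P ?p (unif_indep n E j) + (\<Sum>j=k..<j. irregularity n E j)"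
      using Suc.prems s supp indep_sets_subset_Pow
      by (intro add_mono l1_dist_bind_left Suc.IH) (auto simp: set_pmf_unif_indep simp del: One_nat_def)
    also have "l1_dist ?P ?p (unif_indep n E j) = irregularity n E j"
      unfolding s using Suc.prems s by (intro l1_dist_remove_step) auto
    finally show ?thesis using s by simp
  qed
qed

section \<open>Glauber dynamics\<close>

text \<open>Glauber dynamics with the removals suppressed: a proposal of an occupied vertex leaves
  the set as it is.\<close>

definition grow_step :: "nat \<Rightarrow> nat set set \<Rightarrow> nat set \<Rightarrow> nat set pmf" where
  "grow_step n E S = do {
     v \<leftarrow> pmf_of_set {1..n};
     if v \<in> extensions n E S then pmf_of_set {insert v S, S} else return_pmf S
   }"

text \<open>The two steps differ only when the proposed vertex lies in \<open>S\<close>, which has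
  probability \<open>card S / n\<close>; then the distance is at most 2.\<close>

lemma l1_dist_glauber_grow:
  assumes "independent_set n E S" "n > 0"
  shows "l1_dist B (glauber_step n E S) (grow_step n E S) \<le> 2 * real (card S) / real n"
proof -
  define P where "P v = (if independent_set n E (insert v S) then pmf_of_set {insert v S, S - {v}}
     else return_pmf S)" for v
  define Q where "Q v = (if v \<in> extensions n E S then pmf_of_set {insert v S, S} else return_pmf S)" for v
  have eq: "l1_dist B (P v) (Q v) = 0" if "v \<in> {1..n} - S" for v
  proof -
    have "S - {v} = S" using that by auto
    then have "P v = Q v" using that by (simp add: P_def Q_def extensions_def)
    then show ?thesis by simp
  qed
  have S: "S \<subseteq> {1..n}" using assms(1) by (rule independent_set_subset)
  have le2: "l1_dist B (P v) (Q v) \<le> 2" for v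
  proof (cases "finite B")
    case False
    then show ?thesis by (simp add: l1_dist_def)
  qed (rule l1_dist_le_2)
  have ne: "{1..n} \<noteq> {}" using assms by auto
  have "l1_dist B (glauber_step n E S) (grow_step n E S)
      \<le> (\<Sum>v\<in>{1..n}. pmf (pmf_of_set {1..n}) v * l1_dist B (P v) (Q v))"
    unfolding glauber_step_def grow_step_def P_def[symmetric] Q_def[symmetric]
    using ne by (intro l1_dist_bind_right) auto
  also have "\<dots> = (\<Sum>v\<in>{1..n}. l1_dist B (P v) (Q v) / n)"
    using ne by (intro sum.cong) auto
  also have "\<dots> = (\<Sum>v\<in>S. l1_dist B (P v) (Q v) / n)"
    using S eq by (intro sum.mono_neutral_right) auto
  also have "\<dots> \<le> (\<Sum>v\<in>S. 2 / n)"
    using le2 by (intro sum_mono divide_right_mono) auto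
  finally show ?thesis by (simp add: mult.commute)
qed

text \<open>A given extending vertex is proposed with probability \<open>1 / n\<close> and accepted
  with probability \<open>1 / 2\<close>. For \<open>L\<close> other than \<open>S\<close> the
  counted set has at most one element; it is kept as a cardinality to fit
  \<open>card_extensions_inserting\<close>.\<close>

lemma pmf_grow_step:
  assumes "n > 0"
  shows "pmf (grow_step n E S) L =
    (if L = S then 1 - card (extensions n E S) / (2 * n)
     else card {v \<in> extensions n E S. insert v S = L} / (2 * n))"
proof -
  have ne: "{1..n} \<noteq> {}" using assms by auto
  let ?X = "extensions n E S"
  have X: "?X \<subseteq> {1..n}" by (auto simp: extensions_def)
  have pmf: "pmf (pmf_of_set {insert v S, S}) L = (indicator {insert v S} L + indicator {S} L) / 2"
    if "v \<in> ?X" for v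
  proof -
    have "insert v S \<noteq> S" using that by (auto simp: extensions_def)
    then show ?thesis by (subst pmf_of_set) (auto simp: indicator_def)
  qed
  have "pmf (grow_step n E S) L
      = (\<Sum>v\<in>{1..n}. pmf (if v \<in> ?X then pmf_of_set {insert v S, S} else return_pmf S) L) / n"
    unfolding grow_step_def using ne by (subst pmf_bind_pmf_of_set) auto
  also have "(\<Sum>v\<in>{1..n}. pmf (if v \<in> ?X then pmf_of_set {insert v S, S} else return_pmf S) L)
     = (\<Sum>v\<in>{1..n}. indicator {S} L + (if v \<in> ?X then (indicator {insert v S} L - indicator {S} L) / 2 else 0))"
  proof (intro sum.cong refl)
    fix v
    show "pmf (if v \<in> ?X then pmf_of_set {insert v S, S} else return_pmf S) L
       = indicator {S} L + (if v \<in> ?X then (indicator {insert v S} L - indicator {S} L) / 2 else 0)"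
      using pmf[of v] by (cases "v \<in> ?X") (auto simp: field_simps indicator_def simp del: pmf_of_set)
  qed
  also have "\<dots> = real n * indicator {S} L + (\<Sum>v\<in>?X. (indicator {insert v S} L - indicator {S} L) / 2)"
    using X by (simp add: sum.distrib sum.If_cases Int_absorb1 del: One_nat_def)
  also have "(\<Sum>v\<in>?X. (indicator {insert v S} L - indicator {S} L) / 2)
      = ((\<Sum>v\<in>?X. indicator {insert v S} L) - real (card ?X) * indicator {S} L) / 2"
    by (simp add: sum_subtractf flip: sum_divide_distrib)
  also have "(\<Sum>v\<in>?X. indicator {insert v S} L) = real (card {v \<in> ?X. insert v S = L})"
    by (auto simp: indicator_def sum.If_cases intro!: arg_cong[where f = card])
  finally have "pmf (grow_step n E S) L = (real n * indicator {S} L +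
     (real (card {v \<in> ?X. insert v S = L}) - real (card ?X) * indicator {S} L) / 2) / n" .
  moreover have "{v \<in> ?X. insert v S = S} = {}" by (auto simp: extensions_def)
  ultimately show ?thesis
    using assms by (cases "L = S") (auto simp: field_simps)
qed

text \<open>The probability that a growing step from a uniform independent set of size
  \<open>j\<close> adds a vertex.\<close>

definition level_rate :: "nat \<Rightarrow> nat set set \<Rightarrow> nat \<Rightarrow> real" where
  "level_rate n E j = mean_ext n E j / (2 * real n)"

lemma mean_ext_nonneg: "0 \<le> mean_ext n E j"
  by (simp add: mean_ext_def)

lemma mean_ext_le:
  assumes "0 < num_indep n E j"
  shows "mean_ext n E j \<le> n"
proof -
  have "Suc j * num_indep n E (Suc j) \<le> (\<Sum>K\<in>indep_sets n E j. n)"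
    unfolding sum_card_extensions[symmetric] by (intro sum_mono card_extensions_le)
  then have "real (Suc j * num_indep n E (Suc j)) \<le> real (n * num_indep n E j)"
    by (simp only: sum_constant num_indep_def of_nat_le_iff mult.commute of_nat_id)
  then show ?thesis
    using assms by (simp add: mean_ext_def pos_divide_le_eq)
qed

lemma level_rate:
  assumes "0 < num_indep n E j"
  shows "0 \<le> level_rate n E j" "level_rate n E j \<le> 1"
  using mean_ext_le[OF assms] mean_ext_nonneg[of n E j]
  by (auto simp: level_rate_def divide_le_eq)

definition level_step :: "nat \<Rightarrow> nat set set \<Rightarrow> nat \<Rightarrow> nat \<Rightarrow> nat pmf" where
  "level_step n E k j = (if j < k
     then map_pmf (\<lambda>b. if b then Suc j else j) (bernoulli_pmf (level_rate n E j)) else return_pmf j)"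

text \<open>Each set of size \<open>j + 1\<close> has equally many predecessors, so it receives the
  same mass under both laws. All discrepancy sits on size \<open>j\<close>, where a set stays put
  with a probability given by its own extension count instead of the average one.\<close>

lemma l1_dist_grow_level:
  assumes "n > 0" "j < k" "0 < num_indep n E j" "0 < num_indep n E (Suc j)"
  shows "l1_dist (Pow {1..n}) (bind_pmf (unif_indep n E j) (grow_step n E))
      (bind_pmf (level_step n E k j) (unif_indep n E)) = level_rate n E j * irregularity n E j"
proof -
  let ?I = "indep_sets n E" and ?z = "\<lambda>j. real (num_indep n E j)"
  let ?p = "bind_pmf (unif_indep n E j) (grow_step n E)"
  let ?q = "bind_pmf (level_step n E k j) (unif_indep n E)"
  have disj: "L \<notin> ?I (Suc j)" if "L \<in> ?I j" for L
    using that by (simp add: indep_sets_def)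
  have q: "pmf ?q L = (1 - level_rate n E j) * (indicator (?I j) L / ?z j)
      + level_rate n E j * (indicator (?I (Suc j)) L / ?z (Suc j))" for L
    using assms level_rate[OF assms(3)]
    by (simp add: level_step_def bind_map_pmf pmf_bind pmf_unif_indep mult.commute)
  have rate_div: "level_rate n E j / ?z (Suc j) = real (Suc j) / (2 * n * ?z j)"
    using assms by (simp add: level_rate_def mean_ext_def field_simps del: of_nat_Suc mult_Suc)
  have p: "pmf ?p L = (\<Sum>K\<in>?I j. pmf (grow_step n E K) L) / ?z j" for L
  proof -
    have "pmf ?p L = (\<Sum>K\<in>?I j. pmf (unif_indep n E j) K * pmf (grow_step n E K) L)"
      using assms by (intro pmf_bind_finite) (auto simp: set_pmf_unif_indep)
    also have "\<dots> = (\<Sum>K\<in>?I j. pmf (grow_step n E K) L / ?z j)"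
      using assms by (intro sum.cong) (auto simp: pmf_unif_indep)
    finally show ?thesis by (simp add: sum_divide_distrib)
  qed
  have no_ins: "{v \<in> extensions n E K. insert v K = L} = {}" if "K \<in> ?I j" "L \<notin> ?I (Suc j)" for K L
    using that indep_sets_insert by blast
  have p0: "pmf ?p L - pmf ?q L = 0" if "L \<notin> ?I j" for L
  proof (cases "L \<in> ?I (Suc j)")
    case True
    have "(\<Sum>K\<in>?I j. pmf (grow_step n E K) L) = (\<Sum>K\<in>?I j. card {v \<in> extensions n E K. insert v K = L} / (2 * n))"
      using that assms by (intro sum.cong) (auto simp: pmf_grow_step)
    also have "\<dots> = real (Suc j) / (2 * n)"
      unfolding card_extensions_inserting[OF True, symmetric] by (simp add: sum_divide_distrib)
    finally show ?thesis
      using that True rate_div by (simp add: p q del: of_nat_Suc)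
  next
    case False
    have "pmf (grow_step n E K) L = 0" if "K \<in> ?I j" for K
      using that \<open>L \<notin> ?I j\<close> False assms no_ins[OF that False] by (auto simp: pmf_grow_step)
    then show ?thesis using that False by (simp add: p q)
  qed
  have p1: "pmf ?p L - pmf ?q L = (mean_ext n E j - card (extensions n E L)) / (2 * n * ?z j)" if "L \<in> ?I j" for L
  proof -
    have "(\<Sum>K\<in>?I j. pmf (grow_step n E K) L) = (\<Sum>K\<in>?I j. if K = L then 1 - card (extensions n E L) / (2 * n) else 0)"
      using assms disj[OF that] by (intro sum.cong) (auto simp: pmf_grow_step no_ins)
    then have "pmf ?p L = (1 - card (extensions n E L) / (2 * n)) / ?z j"
      using that by (simp add: p)
    moreover have "pmf ?q L = (1 - mean_ext n E j / (2 * n)) / ?z j"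
      using that disj[OF that] by (simp add: q level_rate_def)
    ultimately show ?thesis using assms by (simp add: field_simps)
  qed
  have "l1_dist (Pow {1..n}) ?p ?q = (\<Sum>L\<in>?I j. \<bar>pmf ?p L - pmf ?q L\<bar>)"
    unfolding l1_dist_def
    by (rule sum.mono_neutral_right) (use assms indep_sets_subset_Pow p0 in auto)
  also have "\<dots> = (\<Sum>L\<in>?I j. \<bar>real (card (extensions n E L)) - mean_ext n E j\<bar> / (2 * n * ?z j))"
    by (intro sum.cong) (auto simp: p1 abs_minus_commute)
  also have "\<dots> = level_rate n E j * irregularity n E j"
    using assms by (simp add: level_rate_def irregularity_def mean_ext_def flip: sum_divide_distrib del: of_nat_Suc mult_Suc)
  finally show ?thesis .
qed

section \<open>The stopped chain and the birth chain of levels\<close>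

definition stopped_step :: "nat \<Rightarrow> nat set set \<Rightarrow> nat \<Rightarrow> nat set \<Rightarrow> nat set pmf" where
  "stopped_step n E k S = (if card S = k then return_pmf S else glauber_step n E S)"

primrec stopped_chain :: "nat \<Rightarrow> nat set set \<Rightarrow> nat \<Rightarrow> nat \<Rightarrow> nat set pmf" where
  "stopped_chain n E k 0 = return_pmf {}"
| "stopped_chain n E k (Suc t) = bind_pmf (stopped_chain n E k t) (stopped_step n E k)"

primrec level_chain :: "nat \<Rightarrow> nat set set \<Rightarrow> nat \<Rightarrow> nat \<Rightarrow> nat pmf" where
  "level_chain n E k 0 = return_pmf 0"
| "level_chain n E k (Suc t) = bind_pmf (level_chain n E k t) (level_step n E k)"

lemma length_glauber_path: "Ss \<in> set_pmf (glauber_path n E T) \<Longrightarrow> length Ss = Suc T"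
  by (induction T arbitrary: Ss) auto

lemma stopping_index_eqI:
  assumes "t = T \<or> card (Ss ! t) = k" "\<And>i. i < t \<Longrightarrow> i \<noteq> T \<and> card (Ss ! i) \<noteq> k"
  shows "stopping_index T k Ss = t"
  unfolding stopping_index_def using assms by (intro Least_equality) (auto simp: not_less[symmetric])

text \<open>Separates a genuine visit to size \<open>k\<close> from stopping because time has run
  out; a first visit exactly at time \<open>T\<close> belongs to \<open>hit\<close>.\<close>

lemma stopping_index_cases:
  obtains (hit) "stopping_index T k Ss \<le> T" "card (Ss ! stopping_index T k Ss) = k"
      "\<And>i. i < stopping_index T k Ss \<Longrightarrow> card (Ss ! i) \<noteq> k"
    | (miss) "stopping_index T k Ss = T" "\<And>i. i \<le> T \<Longrightarrow> card (Ss ! i) \<noteq> k"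
proof -
  let ?P = "\<lambda>t. t = T \<or> card (Ss ! t) = k"
  have 1: "?P (stopping_index T k Ss)" unfolding stopping_index_def by (rule LeastI[of ?P T]) simp
  have 2: "stopping_index T k Ss \<le> T" unfolding stopping_index_def by (rule Least_le[of ?P T]) simp
  have 3: "card (Ss ! i) \<noteq> k" if "i < stopping_index T k Ss" for i
    using not_less_Least[OF that[unfolded stopping_index_def]] by simp
  show ?thesis
  proof (cases "card (Ss ! stopping_index T k Ss) = k")
    case True
    then show ?thesis using hit 2 3 by blast
  next
    case False
    with 1 3 have "stopping_index T k Ss = T" "card (Ss ! i) \<noteq> k" if "i \<le> T" for i
      using that by (auto simp: le_less)
    then show ?thesis using miss by blast
  qed
qed

text \<open>After a visit to size \<open>k\<close> the index is unaffected by later states; without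
  one it moves on to the new last position.\<close>

lemma nth_stopping_index_append:
  assumes "length Ss = Suc T"
  shows "(Ss @ [S]) ! stopping_index (Suc T) k (Ss @ [S])
    = (if card (Ss ! stopping_index T k Ss) = k then Ss ! stopping_index T k Ss else S)"
proof (cases rule: stopping_index_cases[of T k Ss])
  case hit
  have "stopping_index (Suc T) k (Ss @ [S]) = stopping_index T k Ss"
    using hit assms by (intro stopping_index_eqI) (auto simp: nth_append)
  then show ?thesis using hit assms by (simp add: nth_append)
next
  case miss
  have "stopping_index (Suc T) k (Ss @ [S]) = Suc T"
    using miss assms by (intro stopping_index_eqI) (auto simp: nth_append)
  then show ?thesis using miss assms by (simp add: nth_append)
qed

text \<open>Freezing the chain as soon as it has size \<open>k\<close> turns the state at a stopping
  time into the state of a Markov chain at the fixed time \<open>T\<close>.\<close>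

lemma map_stopping_index_glauber_path:
  "map_pmf (\<lambda>Ss. Ss ! stopping_index T k Ss) (glauber_path n E T) = stopped_chain n E k T"
proof (induction T)
  case 0
  then show ?case by (simp add: stopping_index_def)
next
  case (Suc T)
  have "map_pmf (\<lambda>Ss. Ss ! stopping_index (Suc T) k Ss) (glauber_path n E (Suc T))
    = bind_pmf (glauber_path n E T) (\<lambda>Ss. map_pmf (\<lambda>S. (Ss @ [S]) ! stopping_index (Suc T) k (Ss @ [S])) (glauber_step n E (last Ss)))"
    by (simp add: map_bind_pmf map_pmf_def bind_assoc_pmf bind_return_pmf)
  also have "\<dots> = bind_pmf (glauber_path n E T) (\<lambda>Ss. stopped_step n E k (Ss ! stopping_index T k Ss))"
  proof (intro bind_pmf_cong refl)
    fix Ss assume "Ss \<in> set_pmf (glauber_path n E T)"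
    then have len: "length Ss = Suc T" by (rule length_glauber_path)
    have "last Ss = Ss ! T" using len by (subst last_conv_nth) auto
    then show "map_pmf (\<lambda>S. (Ss @ [S]) ! stopping_index (Suc T) k (Ss @ [S])) (glauber_step n E (last Ss))
        = stopped_step n E k (Ss ! stopping_index T k Ss)"
      unfolding nth_stopping_index_append[OF len] stopped_step_def
      by (cases rule: stopping_index_cases[of T k Ss]) auto
  qed
  also have "\<dots> = bind_pmf (map_pmf (\<lambda>Ss. Ss ! stopping_index T k Ss) (glauber_path n E T)) (stopped_step n E k)"
    by (simp add: bind_map_pmf)
  finally show ?case using Suc by simp
qed

lemma glauber_stopped_eq: "glauber_stopped n E k = stopped_chain n E k (glauber_time n k)"
  by (simp add: glauber_stopped_def map_stopping_index_glauber_path)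

lemma set_pmf_glauber_step:
  assumes "n > 0" "independent_set n E S" "S' \<in> set_pmf (glauber_step n E S)"
  shows "independent_set n E S' \<and> card S' \<le> Suc (card S)"
proof -
  from assms obtain v where v: "S' = S \<or> S' = S - {v} \<or> independent_set n E (insert v S) \<and> S' = insert v S"
    by (auto simp: glauber_step_def split: if_splits)
  have "finite S" using assms(2) by (rule finite_independent_set)
  then show ?thesis
    using v assms(2) independent_set_mono[OF assms(2), of "S - {v}"] card_Diff1_le[of S v]
    by (auto simp: card_insert_if le_SucI simp del: card_Diff_singleton)
qed

text \<open>The size grows by at most one per step from 0, so it cannot jump over \<open>k\<close>,
  where the chain freezes.\<close>

lemma set_pmf_stopped_chain:
  assumes "n > 0" "S \<in> set_pmf (stopped_chain n E k t)"
  shows "independent_set n E S \<and> card S \<le> k"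
  using assms(2)
proof (induction t arbitrary: S)
  case (Suc t)
  then obtain S0 where S0: "S0 \<in> set_pmf (stopped_chain n E k t)" "S \<in> set_pmf (stopped_step n E k S0)"
    by auto
  from Suc.IH[OF S0(1)] S0(2) set_pmf_glauber_step[OF assms(1), of E S0 S] show ?case
    by (auto simp: stopped_step_def split: if_splits)
qed simp

lemma set_pmf_level_chain: "set_pmf (level_chain n E k t) \<subseteq> {..k}"
proof (induction t)
  case (Suc t)
  show ?case
  proof
    fix j assume "j \<in> set_pmf (level_chain n E k (Suc t))"
    then obtain i where "i \<in> set_pmf (level_chain n E k t)" "j \<in> set_pmf (level_step n E k i)" by auto
    with Suc show "j \<in> {..k}" by (fastforce simp: level_step_def split: if_splits)
  qed
qed simp

text \<open>The sum of \<open>w\<close> below the current level acts as a potential: it rises by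
  \<open>w j\<close> exactly when the chain passes from \<open>j\<close> to
  \<open>j + 1\<close>.\<close>

lemma expectation_level_step:
  assumes "j < k \<Longrightarrow> 0 < num_indep n E j"
  shows "measure_pmf.expectation (level_step n E k j) (\<lambda>j. \<Sum>i<j. w i)
    = (\<Sum>i<j. w i) + (if j < k then level_rate n E j * w j else 0 :: real)"
  using level_rate[of n E j] assms
  by (auto simp: level_step_def algebra_simps)

text \<open>Applied with two weights: \<open>irregularity\<close> accumulates the errors of the
  comparison, and the inverse rate measures the time spent below \<open>k\<close>.\<close>

lemma expectation_level_chain_Suc:
  fixes w :: "nat \<Rightarrow> real"
  assumes "\<And>j. j < k \<Longrightarrow> 0 < num_indep n E j"
  shows "measure_pmf.expectation (level_chain n E k (Suc t)) (\<lambda>j. \<Sum>i<j. w i)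
    = measure_pmf.expectation (level_chain n E k t) (\<lambda>j. \<Sum>i<j. w i)
      + (\<Sum>j<k. pmf (level_chain n E k t) j * (level_rate n E j * w j))"
proof -
  let ?a = "pmf (level_chain n E k t)"
  have "measure_pmf.expectation (level_chain n E k (Suc t)) (\<lambda>j. \<Sum>i<j. w i)
     = (\<Sum>j\<le>k. ?a j *\<^sub>R measure_pmf.expectation (level_step n E k j) (\<lambda>j. \<Sum>i<j. w i))"
    unfolding level_chain.simps
    by (rule pmf_expectation_bind) (use set_pmf_level_chain[of n E k t] in \<open>auto simp: level_step_def\<close>)
  also have "\<dots> = (\<Sum>j\<le>k. ?a j * (\<Sum>i<j. w i)) + (\<Sum>j\<le>k. if j < k then ?a j * (level_rate n E j * w j) else 0)"
    unfolding sum.distrib[symmetric] using assms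
    by (intro sum.cong) (auto simp: expectation_level_step algebra_simps)
  also have "(\<Sum>j\<le>k. if j < k then ?a j * (level_rate n E j * w j) else 0) = (\<Sum>j<k. ?a j * (level_rate n E j * w j))"
    by (rule sum.mono_neutral_cong_right) auto
  also have "(\<Sum>j\<le>k. ?a j * (\<Sum>i<j. w i)) = measure_pmf.expectation (level_chain n E k t) (\<lambda>j. \<Sum>i<j. w i)"
    by (subst integral_measure_pmf[of "{..k}"]) (use set_pmf_level_chain[of n E k t] in auto)
  finally show ?thesis .
qed

text \<open>A birth chain passes each level at most once, so the accumulated charge is bounded
  uniformly in the running time.\<close>

lemma expectation_level_chain_le:
  fixes w :: "nat \<Rightarrow> real"
  assumes "\<And>i. w i \<ge> 0"
  shows "measure_pmf.expectation (level_chain n E k t) (\<lambda>j. \<Sum>i<j. w i) \<le> (\<Sum>i<k. w i)"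
proof -
  let ?a = "pmf (level_chain n E k t)"
  have "measure_pmf.expectation (level_chain n E k t) (\<lambda>j. \<Sum>i<j. w i) = (\<Sum>j\<le>k. ?a j * (\<Sum>i<j. w i))"
    by (subst integral_measure_pmf[of "{..k}"]) (use set_pmf_level_chain[of n E k t] in auto)
  also have "\<dots> \<le> (\<Sum>j\<le>k. ?a j * (\<Sum>i<k. w i))"
    using assms by (intro sum_mono mult_left_mono sum_mono2) auto
  also have "\<dots> = (\<Sum>i<k. w i)"
    unfolding sum_distrib_right[symmetric]
    using sum_pmf_eq_1[OF _ set_pmf_level_chain, of k n E t] by simp
  finally show ?thesis .
qed

text \<open>With inverse rates as weights, each step raises the potential by the probability of
  being below \<open>k\<close>. This probability decreases in time, so the potential after
  \<open>t\<close> steps is at least \<open>t\<close> times its last value; and it never exceeds the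
  mean hitting time on the right.\<close>

lemma level_chain_miss:
  assumes "\<And>j. j \<le> k \<Longrightarrow> 0 < num_indep n E j" "n > 0"
  shows "real t * (1 - pmf (level_chain n E k t) k) \<le> (\<Sum>i<k. 1 / level_rate n E i)"
proof -
  let ?E = "\<lambda>t. measure_pmf.expectation (level_chain n E k t) (\<lambda>j. \<Sum>i<j. 1 / level_rate n E i)"
  have pos: "level_rate n E i > 0" if "i < k" for i
    using that assms(1)[of i] assms(1)[of "Suc i"] assms(2) by (simp add: level_rate_def mean_ext_def del: of_nat_Suc mult_Suc)
  \<comment> \<open>Level \<open>k\<close> is absorbing.\<close>
  have mono: "pmf (level_chain n E k (Suc t)) k \<ge> pmf (level_chain n E k t) k" for t
  proof -
    have "pmf (level_chain n E k (Suc t)) k = (\<Sum>j\<le>k. pmf (level_chain n E k t) j * pmf (level_step n E k j) k)"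
      unfolding level_chain.simps by (rule pmf_bind_finite) (use set_pmf_level_chain[of n E k t] in auto)
    also have "\<dots> \<ge> (\<Sum>j\<in>{k}. pmf (level_chain n E k t) j * pmf (level_step n E k j) k)"
      by (rule sum_mono2) auto
    finally show ?thesis by (simp add: level_step_def)
  qed
  have "real t * (1 - pmf (level_chain n E k t) k) \<le> ?E t"
  proof (induction t)
    case (Suc t)
    let ?a = "pmf (level_chain n E k t)"
    have "(\<Sum>j<k. ?a j * (level_rate n E j * (1 / level_rate n E j))) = (\<Sum>j<k. ?a j)"
      using pos by (intro sum.cong) (auto simp: less_imp_neq[THEN not_sym])
    also have "\<dots> = 1 - ?a k"
      using sum_pmf_eq_1[OF _ set_pmf_level_chain, of k n E t] by (simp flip: lessThan_Suc_atMost)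
    finally have "?E (Suc t) = ?E t + (1 - ?a k)"
      using assms(1) by (subst expectation_level_chain_Suc) auto
    moreover have "real (Suc t) * (1 - pmf (level_chain n E k (Suc t)) k) \<le> real (Suc t) * (1 - ?a k)"
      using mono[of t] by (intro mult_left_mono) auto
    ultimately show ?case using Suc by (simp add: algebra_simps)
  qed simp
  also have "\<dots> \<le> (\<Sum>i<k. 1 / level_rate n E i)"
    using assms(1) by (intro expectation_level_chain_le) (simp add: level_rate_def mean_ext_nonneg)
  finally show ?thesis .
qed

text \<open>Pass through \<open>grow_step\<close>: suppressing removals costs the second term, and
  the deviation of the growing step from uniformity the first. At level \<open>k\<close> both sides
  stand still.\<close>

lemma l1_dist_stopped_step:
  assumes "n > 0" "j \<le> k" "\<And>i. i \<le> k \<Longrightarrow> 0 < num_indep n E i"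
  shows "l1_dist (Pow {1..n}) (bind_pmf (unif_indep n E j) (stopped_step n E k))
      (bind_pmf (level_step n E k j) (unif_indep n E))
    \<le> (if j < k then level_rate n E j * irregularity n E j else 0) + 2 * real k / real n"
proof (cases "j < k")
  case False
  with assms(2) have [simp]: "j = k" by simp
  have "bind_pmf (unif_indep n E k) (stopped_step n E k) = bind_pmf (unif_indep n E k) return_pmf"
    using assms(3)[of k] by (intro bind_pmf_cong refl) (auto simp: set_pmf_unif_indep indep_sets_def stopped_step_def)
  then show ?thesis
    by (simp add: level_step_def bind_return_pmf bind_return_pmf')
next
  case True
  let ?P = "Pow {1..n}" and ?u = "unif_indep n E j"
  have pos: "0 < num_indep n E j" "0 < num_indep n E (Suc j)" using assms True by auto
  have I: "S \<in> indep_sets n E j \<Longrightarrow> independent_set n E S \<and> card S = j" for S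
    by (simp add: indep_sets_def)
  have "bind_pmf ?u (stopped_step n E k) = bind_pmf ?u (glauber_step n E)"
    using pos True by (intro bind_pmf_cong refl) (auto simp: set_pmf_unif_indep indep_sets_def stopped_step_def)
  then have "l1_dist ?P (bind_pmf ?u (stopped_step n E k)) (bind_pmf (level_step n E k j) (unif_indep n E))
    \<le> l1_dist ?P (bind_pmf ?u (glauber_step n E)) (bind_pmf ?u (grow_step n E))
     + l1_dist ?P (bind_pmf ?u (grow_step n E)) (bind_pmf (level_step n E k j) (unif_indep n E))"
    using l1_dist_triangle by simp
  also have "l1_dist ?P (bind_pmf ?u (grow_step n E)) (bind_pmf (level_step n E k j) (unif_indep n E))
     = level_rate n E j * irregularity n E j"
    by (rule l1_dist_grow_level[OF assms(1) True pos])
  also have "l1_dist ?P (bind_pmf ?u (glauber_step n E)) (bind_pmf ?u (grow_step n E))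
     \<le> (\<Sum>S\<in>indep_sets n E j. pmf ?u S * l1_dist ?P (glauber_step n E S) (grow_step n E S))"
    using pos by (intro l1_dist_bind_right) (auto simp: set_pmf_unif_indep)
  also have "\<dots> \<le> (\<Sum>S\<in>indep_sets n E j. pmf ?u S * (2 * real k / real n))"
  proof (intro sum_mono mult_left_mono)
    fix S assume "S \<in> indep_sets n E j"
    then have S: "independent_set n E S" "card S = j" using I by auto
    have "l1_dist ?P (glauber_step n E S) (grow_step n E S) \<le> 2 * real (card S) / real n"
      by (rule l1_dist_glauber_grow[OF S(1) assms(1)])
    also have "\<dots> \<le> 2 * real k / real n"
      using S(2) assms(2) by (intro divide_right_mono) auto
    finally show "l1_dist ?P (glauber_step n E S) (grow_step n E S) \<le> 2 * real k / real n" .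
  qed simp
  also have "\<dots> \<le> 2 * real k / real n"
    unfolding sum_distrib_right[symmetric]
    by (rule mult_left_le_one_le) (auto intro: sum_nonneg sum_pmf_le_1)
  finally show ?thesis using True by simp
qed

text \<open>The law of the stopped chain stays close to the mixture of uniform laws whose level follows
  a pure birth chain; the error made at level \<open>j\<close> is charged to the passage from \<open>j\<close> to \<open>j + 1\<close>.\<close>

lemma l1_dist_stopped_chain:
  assumes "n > 0" "\<And>i. i \<le> k \<Longrightarrow> 0 < num_indep n E i"
  shows "l1_dist (Pow {1..n}) (stopped_chain n E k t) (bind_pmf (level_chain n E k t) (unif_indep n E))
    \<le> measure_pmf.expectation (level_chain n E k t) (\<lambda>j. \<Sum>i<j. irregularity n E i)
        + real t * (2 * real k / real n)"
proof (induction t)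
  case 0
  have "unif_indep n E 0 = return_pmf {}"
    by (simp add: unif_indep_def pmf_of_set_singleton)
  then show ?case by (simp add: bind_return_pmf)
next
  case (Suc t)
  let ?P = "Pow {1..n}" and ?a = "level_chain n E k t" and ?u = "unif_indep n E"
  let ?st = "stopped_step n E k"
  let ?E = "\<lambda>t. measure_pmf.expectation (level_chain n E k t) (\<lambda>j. \<Sum>i<j. irregularity n E i)"
  have supp: "set_pmf (stopped_chain n E k t) \<subseteq> ?P"
    using set_pmf_stopped_chain[OF assms(1)] independent_set_subset by blast
  have supp': "set_pmf (bind_pmf ?a ?u) \<subseteq> ?P"
  proof
    fix S assume "S \<in> set_pmf (bind_pmf ?a ?u)"
    then obtain j where "j \<in> set_pmf ?a" "S \<in> set_pmf (?u j)" by auto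
    then have "S \<in> indep_sets n E j"
      using set_pmf_level_chain[of n E k t] assms(2) by (auto simp: set_pmf_unif_indep)
    then show "S \<in> ?P" using indep_sets_subset_Pow by blast
  qed
  have "l1_dist ?P (stopped_chain n E k (Suc t)) (bind_pmf (level_chain n E k (Suc t)) ?u)
    \<le> l1_dist ?P (bind_pmf (stopped_chain n E k t) ?st) (bind_pmf (bind_pmf ?a ?u) ?st)
      + l1_dist ?P (bind_pmf (bind_pmf ?a ?u) ?st) (bind_pmf (level_chain n E k (Suc t)) ?u)"
    by (simp add: l1_dist_triangle)
  also have "l1_dist ?P (bind_pmf (stopped_chain n E k t) ?st) (bind_pmf (bind_pmf ?a ?u) ?st)
    \<le> l1_dist ?P (stopped_chain n E k t) (bind_pmf ?a ?u)"
    using supp supp' by (intro l1_dist_bind_left) auto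
  also have "l1_dist ?P (bind_pmf (bind_pmf ?a ?u) ?st) (bind_pmf (level_chain n E k (Suc t)) ?u)
    = l1_dist ?P (bind_pmf ?a (\<lambda>j. bind_pmf (?u j) ?st)) (bind_pmf ?a (\<lambda>j. bind_pmf (level_step n E k j) ?u))"
    by (simp add: bind_assoc_pmf)
  also have "\<dots> \<le> (\<Sum>j\<le>k. pmf ?a j * l1_dist ?P (bind_pmf (?u j) ?st) (bind_pmf (level_step n E k j) ?u))"
    by (rule l1_dist_bind_right) (use set_pmf_level_chain[of n E k t] in auto)
  also have "\<dots> \<le> (\<Sum>j\<le>k. pmf ?a j * ((if j < k then level_rate n E j * irregularity n E j else 0) + 2 * real k / real n))"
    using assms by (intro sum_mono mult_left_mono l1_dist_stopped_step) auto
  also have "\<dots> = (\<Sum>j\<le>k. if j < k then pmf ?a j * (level_rate n E j * irregularity n E j) else 0)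
      + (\<Sum>j\<le>k. pmf ?a j) * (2 * real k / real n)"
    unfolding sum_distrib_right sum.distrib[symmetric] by (intro sum.cong) (auto simp: algebra_simps)
  also have "(\<Sum>j\<le>k. pmf ?a j) = 1"
    using sum_pmf_eq_1[OF _ set_pmf_level_chain, of k n E t] by simp
  also have "(\<Sum>j\<le>k. if j < k then pmf ?a j * (level_rate n E j * irregularity n E j) else 0)
      = (\<Sum>j<k. pmf ?a j * (level_rate n E j * irregularity n E j))"
    by (rule sum.mono_neutral_cong_right) auto
  also have "\<dots> = ?E (Suc t) - ?E t"
    using assms(2) by (subst expectation_level_chain_Suc) auto
  finally have "l1_dist ?P (stopped_chain n E k (Suc t)) (bind_pmf (level_chain n E k (Suc t)) ?u)
    \<le> l1_dist ?P (stopped_chain n E k t) (bind_pmf ?a ?u) + (?E (Suc t) - ?E t + 1 * (2 * real k / real n))"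
    by simp
  then show ?case
    using Suc distrib_right[of 1 "real t" "2 * real k / real n"] unfolding of_nat_Suc by linarith
qed

text \<open>The three terms are the loss of uniformity while growing, the effect of removals during
  \<open>T\<close> steps, and the chance that the birth chain is still below \<open>k\<close> at
  time \<open>T\<close>.\<close>

lemma l1_dist_glauber_stopped:
  assumes "n > 0" "\<And>i. i \<le> k \<Longrightarrow> 0 < num_indep n E i" "T = glauber_time n k" "T > 0"
  shows "l1_dist (Pow {1..n}) (glauber_stopped n E k) (unif_indep n E k)
    \<le> (\<Sum>i<k. irregularity n E i) + 2 * real k * real T / real n
       + 2 * (\<Sum>i<k. 1 / level_rate n E i) / real T"
proof -
  let ?P = "Pow {1..n}" and ?a = "level_chain n E k T" and ?u = "unif_indep n E"
  have "l1_dist ?P (glauber_stopped n E k) (?u k)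
    \<le> l1_dist ?P (glauber_stopped n E k) (bind_pmf ?a ?u) + l1_dist ?P (bind_pmf ?a ?u) (bind_pmf ?a (\<lambda>_. ?u k))"
    by (simp add: l1_dist_triangle)
  also have "l1_dist ?P (glauber_stopped n E k) (bind_pmf ?a ?u)
    \<le> measure_pmf.expectation (level_chain n E k T) (\<lambda>j. \<Sum>i<j. irregularity n E i) + real T * (2 * real k / real n)"
    unfolding glauber_stopped_eq assms(3)[symmetric] by (rule l1_dist_stopped_chain[OF assms(1,2)])
  also have "measure_pmf.expectation (level_chain n E k T) (\<lambda>j. \<Sum>i<j. irregularity n E i)
    \<le> (\<Sum>i<k. irregularity n E i)"
    by (intro expectation_level_chain_le irregularity_nonneg)
  also have "l1_dist ?P (bind_pmf ?a ?u) (bind_pmf ?a (\<lambda>_. ?u k)) \<le> (\<Sum>j\<le>k. pmf ?a j * l1_dist ?P (?u j) (?u k))"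
    by (rule l1_dist_bind_right) (use set_pmf_level_chain[of n E k T] in auto)
  also have "\<dots> = (\<Sum>j<k. pmf ?a j * l1_dist ?P (?u j) (?u k))"
    by (simp flip: lessThan_Suc_atMost)
  also have "\<dots> \<le> (\<Sum>j<k. pmf ?a j * 2)"
    by (intro sum_mono mult_left_mono l1_dist_le_2) auto
  also have "\<dots> = 2 * (1 - pmf ?a k)"
    using sum_pmf_eq_1[OF _ set_pmf_level_chain, of k n E T] by (simp flip: lessThan_Suc_atMost sum_distrib_right)
  also have "1 - pmf ?a k \<le> (\<Sum>i<k. 1 / level_rate n E i) / real T"
    using level_chain_miss[of k n E T] assms(1,2) assms(4) by (simp add: pos_le_divide_eq mult.commute)
  finally show ?thesis by (simp add: mult_ac)
qed

section \<open>The hardcore model\<close>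

lemma set_pmf_hardcore: "set_pmf (hardcore n E) = {S. independent_set n E S}"
  unfolding hardcore_def by (rule set_pmf_of_set) (auto intro: exI[of _ "{}"])

lemma set_pmf_hardcore_subset: "set_pmf (hardcore n E) \<subseteq> Pow {1..n}"
  unfolding set_pmf_hardcore by (auto simp: independent_set_def subset_iff)

lemma pmf_card_hardcore:
  "pmf (map_pmf card (hardcore n E)) s = num_indep n E s / card {S. independent_set n E S}"
proof -
  have "{S. independent_set n E S} \<inter> card -` {s} = indep_sets n E s"
    by (auto simp: indep_sets_def)
  moreover have "{S. independent_set n E S} \<noteq> {}"
    by (auto intro: exI[of _ "{}"])
  ultimately show ?thesis
    by (simp add: hardcore_def pmf_map measure_pmf_of_set num_indep_def)
qed

lemma num_indep_pos_iff: "0 < num_indep n E s \<longleftrightarrow> indep_sets n E s \<noteq> {}"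
  by (simp add: num_indep_def card_gt_0_iff)

lemma set_pmf_card_hardcore: "set_pmf (map_pmf card (hardcore n E)) \<subseteq> {..n}"
proof -
  have "card S \<le> n" if "S \<subseteq> {1..n}" for S
    using card_mono[OF _ that] by simp
  then show ?thesis using set_pmf_hardcore_subset[of n E] by (auto simp del: One_nat_def)
qed

text \<open>At fugacity 1 all independent sets have equal weight, so conditioning on the size leaves
  a uniform law.\<close>

lemma hardcore_decomposition:
  "bind_pmf (map_pmf card (hardcore n E)) (unif_indep n E) = hardcore n E"
proof (rule pmf_eqI)
  fix S
  let ?Z = "real (card {S. independent_set n E S})"
  have ne: "{S. independent_set n E S} \<noteq> {}"
    by (auto intro: exI[of _ "{}"])
  have "pmf (bind_pmf (map_pmf card (hardcore n E)) (unif_indep n E)) S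
     = (\<Sum>s\<le>n. pmf (map_pmf card (hardcore n E)) s * pmf (unif_indep n E s) S)"
    by (rule pmf_bind_finite[OF _ set_pmf_card_hardcore]) simp
  also have "\<dots> = (\<Sum>s\<le>n. indicator (indep_sets n E s) S / ?Z)"
  proof (intro sum.cong refl)
    fix s
    show "pmf (map_pmf card (hardcore n E)) s * pmf (unif_indep n E s) S = indicator (indep_sets n E s) S / ?Z"
    proof (cases "0 < num_indep n E s")
      case True
      then show ?thesis by (simp add: pmf_card_hardcore pmf_unif_indep)
    next
      \<comment> \<open>On an empty level \<open>unif_indep\<close> is an unspecified law, but the
        level has weight 0.\<close>
      case False
      then have "num_indep n E s = 0" "indep_sets n E s = {}"
        using num_indep_pos_iff by auto
      then show ?thesis by (simp add: pmf_card_hardcore)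
    qed
  qed
  also have "\<dots> = (\<Sum>s\<in>{card S}. indicator (indep_sets n E s) S / ?Z)"
  proof (rule sum.mono_neutral_cong)
    fix s assume "s \<in> {card S} - {..n}"
    then have "\<not> S \<subseteq> {1..n}" using card_mono[of "{1..n}" S] by auto
    then show "indicator (indep_sets n E s) S / ?Z = 0"
      using independent_set_subset[of n E S] by (auto simp only: indep_sets_def indicator_def mem_Collect_eq of_bool_def div_0 if_False split: if_splits)
  qed (auto simp: indep_sets_def)
  also have "\<dots> = pmf (hardcore n E) S"
    using ne by (simp add: hardcore_def indep_sets_def indicator_def)
  finally show "pmf (bind_pmf (map_pmf card (hardcore n E)) (unif_indep n E)) S = pmf (hardcore n E) S" .
qed

text \<open>Condition on the size: sizes in the window are handled by \<open>l1_dist_shrink\<close>,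
  and the others contribute at most 2 times their probability.\<close>

lemma l1_dist_shrink_hardcore:
  assumes "k \<le> m" "\<And>j. j \<le> m \<Longrightarrow> 0 < num_indep n E j"
  shows "l1_dist (Pow {1..n}) (bind_pmf (hardcore n E) (shrink k n)) (unif_indep n E k)
    \<le> (\<Sum>j=k..<m. irregularity n E j)
        + 2 * measure_pmf.prob (hardcore n E) {S. card S \<notin> {k..m}}"
proof -
  let ?P = "Pow {1..n}" and ?u = "unif_indep n E"
  let ?\<Lambda> = "map_pmf card (hardcore n E)"
  let ?I = "\<Sum>j=k..<m. irregularity n E j"
  have sum1: "(\<Sum>s\<le>n. pmf ?\<Lambda> s) = 1"
    by (rule sum_pmf_eq_1[OF _ set_pmf_card_hardcore]) simp
  have "bind_pmf (hardcore n E) (shrink k n) = bind_pmf ?\<Lambda> (\<lambda>s. bind_pmf (?u s) (shrink k n))"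
    by (subst hardcore_decomposition[symmetric]) (rule bind_assoc_pmf)
  then have "l1_dist ?P (bind_pmf (hardcore n E) (shrink k n)) (?u k)
    = l1_dist ?P (bind_pmf ?\<Lambda> (\<lambda>s. bind_pmf (?u s) (shrink k n))) (bind_pmf ?\<Lambda> (\<lambda>_. ?u k))"
    by simp
  also have "\<dots> \<le> (\<Sum>s\<le>n. pmf ?\<Lambda> s * l1_dist ?P (bind_pmf (?u s) (shrink k n)) (?u k))"
    by (rule l1_dist_bind_right[OF _ set_pmf_card_hardcore]) simp
  also have "\<dots> \<le> (\<Sum>s\<le>n. pmf ?\<Lambda> s * (?I + 2 * indicator (- {k..m}) s))"
  proof (intro sum_mono mult_left_mono)
    fix s assume s: "s \<in> {..n}"
    show "l1_dist ?P (bind_pmf (?u s) (shrink k n)) (?u k) \<le> ?I + 2 * indicator (- {k..m}) s"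
    proof (cases "s \<in> {k..m}")
      case True
      then have "l1_dist ?P (bind_pmf (?u s) (shrink k n)) (?u k) \<le> (\<Sum>j=k..<s. irregularity n E j)"
        using s assms(2) by (intro l1_dist_shrink) auto
      also have "\<dots> \<le> ?I"
        using True by (intro sum_mono2) (auto simp: irregularity_nonneg)
      finally show ?thesis using True by simp
    next
      case False
      have "0 \<le> ?I" by (intro sum_nonneg irregularity_nonneg)
      then show ?thesis using False l1_dist_le_2[of ?P "bind_pmf (?u s) (shrink k n)" "?u k"] by simp
    qed
  qed simp
  also have "\<dots> = (\<Sum>s\<le>n. pmf ?\<Lambda> s) * ?I + 2 * (\<Sum>s\<le>n. pmf ?\<Lambda> s * indicator (- {k..m}) s)"
    unfolding sum_distrib_right[of _ _ ?I] sum_distrib_left[of 2] sum.distrib[symmetric]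
    by (intro sum.cong refl) (simp only: distrib_left mult.left_commute)
  also have "(\<Sum>s\<le>n. pmf ?\<Lambda> s) * ?I = ?I"
    using sum1 by simp
  also have "(\<Sum>s\<le>n. pmf ?\<Lambda> s * indicator (- {k..m}) s) = measure_pmf.expectation ?\<Lambda> (indicator (- {k..m}))"
    by (subst integral_measure_pmf[of "{..n}"]) (use set_pmf_card_hardcore[of n E] in auto)
  also have "\<dots> = measure_pmf.prob (hardcore n E) {S. card S \<notin> {k..m}}"
    by (simp add: vimage_def)
  finally show ?thesis .
qed

text \<open>Take a hardcore set \<open>S\<close>, shrink it to \<open>K\<close>, and couple
  \<open>K\<close> optimally with the Glauber sample \<open>Y\<close>. If \<open>K = Y\<close> and
  the size of \<open>S\<close> lies in the window, the overlap is \<open>k\<close>. The mean sizes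
  are at most \<open>a\<close> and \<open>k\<close>, so the normalized overlap is at least
  \<open>(1 - D) * k / sqrt (a * k)\<close>.\<close>

lemma w2_hardcore_glauber_le:
  fixes D a :: real and n k :: nat
  defines "T \<equiv> glauber_time n k"
  assumes "n > 0" "0 < k" "k \<le> m" "\<And>j. j \<le> m \<Longrightarrow> 0 < num_indep n E j" "T > 0"
  assumes D: "(\<Sum>i<m. irregularity n E i) + 2 * real k * real T / real n
     + 2 * (\<Sum>i<k. 1 / level_rate n E i) / real T
     + 3 * measure_pmf.prob (hardcore n E) {S. card S \<notin> {k..m}} \<le> D" and "D < 1"
  assumes a: "measure_pmf.expectation (hardcore n E) (\<lambda>S. real (card S)) \<le> a"
  shows "w2 n (subset_law n (hardcore n E)) (subset_law n (glauber_stopped n E k))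
    \<le> sqrt (2 - 2 * (1 - D) * sqrt (real k / a))"
proof -
  let ?P = "Pow {1..n}"
  define H where "H = hardcore n E"
  define g where "g = glauber_stopped n E k"
  define \<kappa> where "\<kappa> = bind_pmf H (shrink k n)"
  let ?out = "measure_pmf.prob H {S. card S \<notin> {k..m}}"
  have g_supp: "S \<subseteq> {1..n} \<and> card S \<le> k" if "S \<in> set_pmf g" for S
    using set_pmf_stopped_chain[OF \<open>n > 0\<close>, of S E k T] that independent_set_subset[of n E S]
    by (simp add: g_def glauber_stopped_eq T_def del: One_nat_def)
  have H_supp: "S \<subseteq> {1..n}" "finite S" "card S \<le> n" if "S \<in> set_pmf H" for S
  proof -
    show "S \<subseteq> {1..n}" using that set_pmf_hardcore_subset[of n E] unfolding H_def by blast
    then show "finite S" "card S \<le> n" using finite_subset card_mono[of "{1..n}" S] by auto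
  qed
  have K_supp: "K \<subseteq> S \<and> (card S \<in> {k..m} \<longrightarrow> card K = k)" if "S \<in> set_pmf H" "K \<in> set_pmf (shrink k n S)" for S K
    using set_pmf_shrink[OF H_supp(2) that(2)] H_supp(3) that(1) by fastforce
  have \<kappa>_supp: "set_pmf \<kappa> \<subseteq> ?P"
    unfolding \<kappa>_def using H_supp(1) K_supp by fastforce
  have "l1_dist ?P \<kappa> g \<le> l1_dist ?P \<kappa> (unif_indep n E k) + l1_dist ?P (unif_indep n E k) g"
    by (rule l1_dist_triangle)
  also have "l1_dist ?P \<kappa> (unif_indep n E k) \<le> (\<Sum>j=k..<m. irregularity n E j) + 2 * ?out"
    unfolding \<kappa>_def H_def using assms by (intro l1_dist_shrink_hardcore) auto
  also have "l1_dist ?P (unif_indep n E k) g \<le> (\<Sum>i<k. irregularity n E i) + 2 * real k * real T / real n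
       + 2 * (\<Sum>i<k. 1 / level_rate n E i) / real T"
    unfolding g_def by (subst l1_dist_commute, rule l1_dist_glauber_stopped) (use assms in auto)
  finally have "l1_dist ?P \<kappa> g \<le> (\<Sum>i<k. irregularity n E i) + (\<Sum>j=k..<m. irregularity n E j)
      + 2 * real k * real T / real n + 2 * (\<Sum>i<k. 1 / level_rate n E i) / real T + 2 * ?out"
    by simp
  also have "(\<Sum>i<k. irregularity n E i) + (\<Sum>j=k..<m. irregularity n E j) = (\<Sum>i<m. irregularity n E i)"
    using \<open>k \<le> m\<close> sum.atLeastLessThan_concat[of 0 k m "irregularity n E"] by (simp add: lessThan_atLeast0)
  \<comment> \<open>Of the three copies of the outside probability in \<open>D\<close>, two enter
    the l1 distance; the third is reserved for the event that \<open>S\<close> itself has a bad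
    size.\<close>
  finally have l1: "l1_dist ?P \<kappa> g \<le> D - ?out"
    using D by (simp add: H_def)
  obtain r where r: "bind_pmf \<kappa> r = g"
      "measure_pmf.prob (bind_pmf \<kappa> (\<lambda>x. map_pmf (Pair x) (r x))) {(x, y). x \<noteq> y} \<le> l1_dist ?P \<kappa> g"
    using ex_coupling_kernel[OF _ \<kappa>_supp, of g] g_supp by auto
  \<comment> \<open>Since \<open>Y\<close> is drawn from \<open>K\<close> alone, the last two
    components form the coupling just obtained, while the first keeps the hardcore law.\<close>
  define d where "d = bind_pmf H (\<lambda>S. bind_pmf (shrink k n S) (\<lambda>K. map_pmf (\<lambda>Y. (S, K, Y)) (r K)))"
  define c where "c = map_pmf (\<lambda>(S, K, Y). (S, Y)) d"
  have d1: "map_pmf fst d = H"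
    by (simp add: d_def map_bind_pmf pmf.map_comp comp_def bind_return_pmf' flip: map_pmf_def)
  have d23: "map_pmf snd d = bind_pmf \<kappa> (\<lambda>x. map_pmf (Pair x) (r x))"
    by (simp add: d_def \<kappa>_def map_bind_pmf pmf.map_comp comp_def bind_assoc_pmf)
  have d3: "map_pmf (snd \<circ> snd) d = g"
    unfolding pmf.map_comp[symmetric] d23 by (simp add: map_bind_pmf pmf.map_comp comp_def r(1))
  have c1: "map_pmf fst c = H" and c2: "map_pmf snd c = g"
    using d1 d3 by (simp_all add: c_def pmf.map_comp comp_def case_prod_unfold)
  have d_supp: "S \<in> set_pmf H \<and> K \<in> set_pmf (shrink k n S) \<and> Y \<in> set_pmf g" if "(S, K, Y) \<in> set_pmf d" for S K Y
    using that unfolding r(1)[symmetric] d_def \<kappa>_def by auto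
  have fin_d: "finite (set_pmf d)"
  proof (rule finite_subset)
    show "set_pmf d \<subseteq> ?P \<times> ?P \<times> ?P"
      using d_supp H_supp(1) K_supp g_supp by fastforce
  qed simp
  have meet: "real k * (1 - ?out - l1_dist ?P \<kappa> g) \<le> measure_pmf.expectation c (\<lambda>(S, Y). real (card (S \<inter> Y)))"
  proof -
    let ?A = "{x. card (fst x) \<notin> {k..m}}" and ?B = "{x. fst (snd x) \<noteq> snd (snd x)}"
    have "measure_pmf.prob d ?A = ?out"
      unfolding d1[symmetric] by (simp add: vimage_def)
    moreover have "measure_pmf.prob d ?B = measure_pmf.prob (map_pmf snd d) {(x, y). x \<noteq> y}"
      by (simp add: vimage_def case_prod_unfold)
    ultimately have "real k * (1 - ?out - l1_dist ?P \<kappa> g)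
       \<le> real k * (1 - measure_pmf.prob d ?A - measure_pmf.prob d ?B)"
      using r(2) d23 by (intro mult_left_mono) auto
    also have "\<dots> = measure_pmf.expectation d (\<lambda>x. real k * (1 - indicator ?A x - indicator ?B x))"
      by (simp add: integrable_measure_pmf_finite[OF fin_d])
    also have "\<dots> \<le> measure_pmf.expectation d (\<lambda>(S, K, Y). real (card (S \<inter> Y)))"
    proof (rule integral_mono_AE)
      show "AE x in measure_pmf d. real k * (1 - indicator ?A x - indicator ?B x)
          \<le> (case x of (S, K, Y) \<Rightarrow> real (card (S \<inter> Y)))"
      proof (rule AE_pmfI, clarify)
        fix S K Y assume x: "(S, K, Y) \<in> set_pmf d"
        show "real k * (1 - indicator ?A (S, K, Y) - indicator ?B (S, K, Y)) \<le> real (card (S \<inter> Y))"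
        proof (cases "card S \<in> {k..m} \<and> K = Y")
          case True
          then have "card (S \<inter> Y) = k" using K_supp d_supp[OF x] by (auto simp: Int_absorb1)
          moreover have "real k * (1 - indicator ?A (S, K, Y) - indicator ?B (S, K, Y)) \<le> real k * 1"
            by (intro mult_left_mono) (auto simp: indicator_def)
          ultimately show ?thesis by simp
        next
          case False
          then have "real k * (1 - indicator ?A (S, K, Y) - indicator ?B (S, K, Y)) \<le> 0"
            by (intro mult_nonneg_nonpos) (auto simp: indicator_def)
          then show ?thesis by linarith
        qed
      qed
    qed (simp_all add: integrable_measure_pmf_finite[OF fin_d])
    also have "\<dots> = measure_pmf.expectation c (\<lambda>(S, Y). real (card (S \<inter> Y)))"
      by (simp add: c_def case_prod_unfold)
    finally show ?thesis .
  qed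
  let ?EH = "measure_pmf.expectation H (\<lambda>S. real (card S))"
  let ?Eg = "measure_pmf.expectation g (\<lambda>S. real (card S))"
  let ?Ec = "measure_pmf.expectation c (\<lambda>(S, Y). real (card (S \<inter> Y)))"
  have fin_c: "finite (set_pmf c)" using fin_d by (simp add: c_def)
  have c_supp: "S \<in> set_pmf H \<and> Y \<in> set_pmf g" if "(S, Y) \<in> set_pmf c" for S Y
    using that d_supp by (auto simp: c_def)
  have kEc: "real k * (1 - D) \<le> ?Ec"
    using l1 by (intro order.trans[OF _ meet] mult_left_mono) auto
  \<comment> \<open>The overlap is at most the size of either set, so its positivity yields both
    positivity conditions of \<open>w2_le_coupling\<close>.\<close>
  then have Ec_pos: "0 < ?Ec"
    using \<open>0 < k\<close> \<open>D < 1\<close> by (smt (verit) mult_pos_pos of_nat_0_less_iff)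
  have "?Ec \<le> measure_pmf.expectation c (\<lambda>x. real (card (fst x)))"
  proof (rule integral_mono_AE)
    show "AE x in measure_pmf c. (case x of (S, Y) \<Rightarrow> real (card (S \<inter> Y))) \<le> real (card (fst x))"
      using c_supp H_supp(2) by (intro AE_pmfI) (auto intro!: card_mono)
  qed (simp_all add: integrable_measure_pmf_finite[OF fin_c])
  also have "\<dots> = ?EH" by (simp add: c1[symmetric])
  finally have EH_pos: "0 < ?EH" using Ec_pos by simp
  have "?Ec \<le> measure_pmf.expectation c (\<lambda>x. real (card (snd x)))"
  proof (rule integral_mono_AE)
    have "finite Y" if "(S, Y) \<in> set_pmf c" for S Y
      using c_supp[OF that] g_supp finite_subset by blast
    then show "AE x in measure_pmf c. (case x of (S, Y) \<Rightarrow> real (card (S \<inter> Y))) \<le> real (card (snd x))"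
      by (intro AE_pmfI) (auto intro!: card_mono)
  qed (simp_all add: integrable_measure_pmf_finite[OF fin_c])
  also have "\<dots> = ?Eg" by (simp add: c2[symmetric])
  finally have Eg_pos: "0 < ?Eg" using Ec_pos by simp
  have fin_g: "finite (set_pmf g)"
    unfolding c2[symmetric] using fin_c by simp
  have "?Eg \<le> measure_pmf.expectation g (\<lambda>_. real k)"
    using g_supp by (intro integral_mono_AE AE_pmfI integrable_measure_pmf_finite[OF fin_g]) simp
  then have Eg_le: "?Eg \<le> real k" by simp
  have "w2 n (subset_law n H) (subset_law n g) \<le> sqrt (2 - 2 * ?Ec / (sqrt ?EH * sqrt ?Eg))"
    using w2_le_coupling[of c n] EH_pos Eg_pos H_supp(1) g_supp unfolding c1 c2 by blast
  also have "\<dots> \<le> sqrt (2 - 2 * (1 - D) * sqrt (real k / a))"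
  proof (rule real_sqrt_le_mono)
    have "(1 - D) * sqrt (real k / a) = real k * (1 - D) / (sqrt a * sqrt k)"
    proof -
      have "real k * (1 - D) / (sqrt a * sqrt k) = (1 - D) * (real k / sqrt (real k)) / sqrt a"
        by (simp add: mult_ac)
      then show ?thesis
        by (simp add: real_div_sqrt real_sqrt_divide)
    qed
    also have "\<dots> \<le> ?Ec / (sqrt ?EH * sqrt ?Eg)"
      using kEc Ec_pos EH_pos Eg_pos Eg_le a by (intro frac_le mult_mono) (auto simp: H_def)
    finally have "2 * ((1 - D) * sqrt (real k / a)) \<le> 2 * (?Ec / (sqrt ?EH * sqrt ?Eg))"
      by (rule mult_left_mono) simp
    then show "2 - 2 * ?Ec / (sqrt ?EH * sqrt ?Eg) \<le> 2 - 2 * (1 - D) * sqrt (real k / a)"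
      unfolding mult.assoc times_divide_eq_right[symmetric] by (rule diff_left_mono)
  qed
  finally show ?thesis by (simp add: H_def g_def)
qed

section \<open>First moments in the random graph\<close>

text \<open>Independence and extendability both say that certain pairs are absent. Such events are
  closed under intersection, and their probability depends only on the number of pairs.\<close>

definition avoids :: "nat set set \<Rightarrow> nat set set set" where
  "avoids F = {E. F \<inter> E = {}}"

lemma finite_vertex_pairs [simp]: "finite (vertex_pairs n)"
  unfolding vertex_pairs_def by (rule finite_subset[of _ "Pow {1..n}"]) auto

lemma set_pmf_erdos_renyi: "set_pmf (erdos_renyi n p) \<subseteq> Pow (vertex_pairs n)"
  by (auto simp: erdos_renyi_def)

lemma finite_set_pmf_erdos_renyi: "finite (set_pmf (erdos_renyi n p))"
  by (rule finite_subset[OF set_pmf_erdos_renyi]) simp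

lemma integrable_erdos_renyi [simp]: "integrable (measure_pmf (erdos_renyi n p)) (f :: _ \<Rightarrow> real)"
  by (rule integrable_measure_pmf_finite[OF finite_set_pmf_erdos_renyi])

lemma prob_avoids:
  assumes "F \<subseteq> vertex_pairs n"
  shows "measure_pmf.prob (erdos_renyi n (1/2)) (avoids F) = (1/2) ^ card F"
proof -
  let ?B = "\<lambda>e. if e \<in> F then {False} else UNIV"
  have "(\<lambda>present. {e \<in> vertex_pairs n. present e}) -` avoids F = Pi (vertex_pairs n) ?B"
    using assms by (auto simp: avoids_def Pi_def split: if_splits)
  then have "measure_pmf.prob (erdos_renyi n (1/2)) (avoids F)
     = (\<Prod>e\<in>vertex_pairs n. measure_pmf.prob (bernoulli_pmf (1/2)) (?B e))"
    by (simp add: erdos_renyi_def measure_Pi_pmf_Pi)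
  also have "\<dots> = (\<Prod>e\<in>vertex_pairs n. if e \<in> F then 1/2 else 1)"
    by (intro prod.cong refl) (auto simp: measure_pmf_single)
  also have "\<dots> = (1/2) ^ card F"
    using assms by (simp add: prod.If_cases Int_absorb1)
  finally show ?thesis .
qed

lemma expectation_avoids:
  assumes "F \<subseteq> vertex_pairs n"
  shows "measure_pmf.expectation (erdos_renyi n (1/2)) (indicat_real (avoids F)) = (1/2) ^ card F"
  by (simp add: prob_avoids[OF assms])

section \<open>The pairs deciding independence and extension\<close>

definition inner_pairs :: "nat set \<Rightarrow> nat set set" where
  "inner_pairs K = {e. e \<subseteq> K \<and> card e = 2}"

definition star :: "nat set \<Rightarrow> nat \<Rightarrow> nat set set" where
  "star K v = (\<lambda>u. {u, v}) ` K"

lemma card_inner_pairs: "finite K \<Longrightarrow> card (inner_pairs K) = card K choose 2"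
  unfolding inner_pairs_def by (rule n_subsets)

lemma finite_inner_pairs: "finite K \<Longrightarrow> finite (inner_pairs K)"
  unfolding inner_pairs_def by (rule finite_subset[of _ "Pow K"]) auto

lemma card_star: "card (star K v) = card K"
  unfolding star_def by (intro card_image inj_onI) (auto simp: doubleton_eq_iff)

lemma star_disjoint:
  assumes "v \<notin> K" "w \<notin> K" "v \<noteq> w"
  shows "inner_pairs K \<inter> star K v = {}" "star K v \<inter> star K w = {}"
  using assms by (auto simp: inner_pairs_def star_def doubleton_eq_iff)

text \<open>\<open>independent_set\<close> also ranges over \<open>u = v\<close>, that is, over
  loops \<open>{u}\<close>; these are never edges because \<open>E\<close> consists of
  pairs.\<close>

lemma independent_set_iff_avoids:
  assumes "E \<subseteq> vertex_pairs n" "K \<subseteq> {1..n}"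
  shows "independent_set n E K \<longleftrightarrow> E \<in> avoids (inner_pairs K)"
proof
  assume "independent_set n E K"
  then show "E \<in> avoids (inner_pairs K)"
    by (auto simp: independent_set_def avoids_def inner_pairs_def card_2_iff)
next
  assume *: "E \<in> avoids (inner_pairs K)"
  have "{u, v} \<notin> E" if "u \<in> K" "v \<in> K" for u v
  proof
    assume "{u, v} \<in> E"
    with assms(1) have "card {u, v} = 2" by (auto simp: vertex_pairs_def)
    with that have "{u, v} \<in> inner_pairs K" by (simp add: inner_pairs_def)
    with * \<open>{u, v} \<in> E\<close> show False by (auto simp: avoids_def)
  qed
  with assms(2) show "independent_set n E K" by (simp add: independent_set_def)
qed

lemma extensions_eq_avoids:
  assumes "E \<subseteq> vertex_pairs n" "independent_set n E K"
  shows "extensions n E K = {v \<in> {1..n} - K. E \<in> avoids (star K v)}"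
proof -
  have "independent_set n E (insert v K) \<longleftrightarrow> E \<in> avoids (star K v)" if v: "v \<in> {1..n} - K" for v
  proof -
    have "{v} \<notin> E" using assms(1) by (auto simp: vertex_pairs_def)
    then show ?thesis
      using assms(2) v
      by (simp add: independent_set_def avoids_def star_def insert_commute disjoint_iff image_iff) blast
  qed
  then show ?thesis by (auto simp: extensions_def)
qed

text \<open>The expectation of \<open>num_indep n E j\<close> over the random graph.\<close>

definition num_indep_mean :: "nat \<Rightarrow> nat \<Rightarrow> real" where
  "num_indep_mean n j = real (n choose j) * (1/2) ^ (j choose 2)"

text \<open>The mean extension count of an independent \<open>j\<close>-set: each outside vertex has
  no neighbour in it with probability \<open>1 / 2 ^ j\<close>.\<close>

definition ext_mean :: "nat \<Rightarrow> nat \<Rightarrow> real" where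
  "ext_mean n j = real (n - j) / 2 ^ j"

text \<open>Like the numerator of \<open>irregularity\<close>, but centred at a deterministic value,
  which makes its expectation accessible.\<close>

definition ext_deviation :: "nat \<Rightarrow> nat set set \<Rightarrow> nat \<Rightarrow> real" where
  "ext_deviation n E j = (\<Sum>K\<in>indep_sets n E j. \<bar>real (card (extensions n E K)) - ext_mean n j\<bar>)"

lemma num_indep_mean_0 [simp]: "num_indep_mean n 0 = 1"
  by (simp add: num_indep_mean_def numeral_2_eq_2)

lemma num_indep_mean_pos: "j \<le> n \<Longrightarrow> 0 < num_indep_mean n j"
  by (simp add: num_indep_mean_def)

text \<open>The averaged form of \<open>sum_card_extensions\<close>. Actual and expected counts thus
  obey the same recursion, up to the deviation.\<close>

lemma num_indep_mean_Suc:
  "real (Suc j) * num_indep_mean n (Suc j) = ext_mean n j * num_indep_mean n j"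
proof -
  have "Suc j * (n choose Suc j) = (n - j) * (n choose j)"
    by (metis binomial_absorb_comp binomial_absorption)
  then have "real (Suc j) * real (n choose Suc j) = real (n - j) * real (n choose j)"
    by (metis of_nat_mult)
  moreover have "Suc j choose 2 = j + (j choose 2)"
    by (simp add: numeral_2_eq_2)
  ultimately show ?thesis
    by (simp add: num_indep_mean_def ext_mean_def power_add power_divide field_simps del: of_nat_Suc)
qed

lemma real_num_indep:
  assumes "E \<subseteq> vertex_pairs n"
  shows "real (num_indep n E j) = (\<Sum>K | K \<subseteq> {1..n} \<and> card K = j. indicator (avoids (inner_pairs K)) E)"
proof -
  have "indep_sets n E j = {K. (K \<subseteq> {1..n} \<and> card K = j) \<and> E \<in> avoids (inner_pairs K)}"
    using independent_set_iff_avoids[OF assms] independent_set_subset[of n E]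
    by (auto simp: indep_sets_def simp del: One_nat_def)
  moreover have "finite {K. K \<subseteq> {1..n} \<and> card K = j}" by simp
  ultimately show ?thesis
    by (simp add: num_indep_def indicator_def sum.If_cases Collect_conj_eq Int_assoc)
qed

text \<open>The sum now runs over all \<open>j\<close>-sets instead of a random family, and the
  extension count is a sum of indicators, each centred at its own mean.\<close>

lemma ext_deviation_eq:
  assumes "E \<subseteq> vertex_pairs n"
  shows "ext_deviation n E j = (\<Sum>K | K \<subseteq> {1..n} \<and> card K = j. indicator (avoids (inner_pairs K)) E *
     \<bar>\<Sum>v\<in>{1..n} - K. indicator (avoids (star K v)) E - (1/2) ^ j\<bar>)"
proof -
  have eq: "indep_sets n E j = {K. (K \<subseteq> {1..n} \<and> card K = j) \<and> E \<in> avoids (inner_pairs K)}"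
    using independent_set_iff_avoids[OF assms] independent_set_subset[of n E]
    by (auto simp: indep_sets_def simp del: One_nat_def)
  have fin: "finite {K. K \<subseteq> {1..n} \<and> card K = j}" by simp
  have "ext_deviation n E j = (\<Sum>K\<in>indep_sets n E j.
     \<bar>\<Sum>v\<in>{1..n} - K. indicator (avoids (star K v)) E - (1/2) ^ j\<bar>)"
    unfolding ext_deviation_def
  proof (intro sum.cong refl)
    fix K assume K: "K \<in> indep_sets n E j"
    then have ind: "independent_set n E K" "card K = j" by (auto simp: indep_sets_def)
    have "(\<Sum>v\<in>{1..n} - K. indicator (avoids (star K v)) E) = real (card (extensions n E K))"
    proof -
      have "extensions n E K = ({1..n} - K) \<inter> {v. E \<in> avoids (star K v)}"
        unfolding extensions_eq_avoids[OF assms ind(1)] by blast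
      then show ?thesis by (simp add: indicator_def sum.If_cases)
    qed
    moreover have "card ({1..n} - K) = n - j"
      using ind independent_set_subset[OF ind(1)] finite_independent_set[OF ind(1)]
      by (simp add: card_Diff_subset del: One_nat_def)
    ultimately show "\<bar>real (card (extensions n E K)) - ext_mean n j\<bar>
      = \<bar>\<Sum>v\<in>{1..n} - K. indicator (avoids (star K v)) E - (1/2) ^ j\<bar>"
      by (simp add: sum_subtractf ext_mean_def power_divide)
  qed
  also have "\<dots> = (\<Sum>K | K \<subseteq> {1..n} \<and> card K = j. indicator (avoids (inner_pairs K)) E *
     \<bar>\<Sum>v\<in>{1..n} - K. indicator (avoids (star K v)) E - (1/2) ^ j\<bar>)"
    unfolding eq using fin
    by (intro sum.mono_neutral_cong_left) auto
  finally show ?thesis .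
qed

lemma inner_pairs_subset: "K \<subseteq> {1..n} \<Longrightarrow> inner_pairs K \<subseteq> vertex_pairs n"
  by (auto simp: inner_pairs_def vertex_pairs_def)

lemma star_subset: "K \<subseteq> {1..n} \<Longrightarrow> v \<in> {1..n} - K \<Longrightarrow> star K v \<subseteq> vertex_pairs n"
  by (auto simp: star_def vertex_pairs_def card_2_iff subset_iff)

lemma indicator_avoids_mult:
  "indicator (avoids F) E * indicator (avoids G) E = (indicator (avoids (F \<union> G)) E :: real)"
  by (auto simp: avoids_def indicator_def)

text \<open>The edges inside \<open>K\<close> and the stars at \<open>v\<close> and \<open>w\<close> are disjoint, so only the diagonal
  terms contribute to the variance of the number of extensions.\<close>

lemma expectation_star_product:
  assumes "K \<subseteq> {1..n}" "card K = j" "v \<in> {1..n} - K" "w \<in> {1..n} - K"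
  shows "measure_pmf.expectation (erdos_renyi n (1/2)) (\<lambda>E. indicat_real (avoids (inner_pairs K)) E *
     ((indicator (avoids (star K v)) E - (1/2) ^ j) * (indicator (avoids (star K w)) E - (1/2) ^ j)))
     \<le> (if v = w then (1/2) ^ (j choose 2) * (1/2) ^ j else 0)"
proof -
  let ?E = "measure_pmf.expectation (erdos_renyi n (1/2))"
  let ?ind = "\<lambda>F E. indicator (avoids F) E :: real"
  let ?I = "inner_pairs K" and ?q = "(1/2 :: real) ^ j" and ?c = "(1/2 :: real) ^ (j choose 2)"
  have fin: "finite K" using assms(1) finite_subset by blast
  have fins: "finite (star K x)" for x using fin by (simp add: star_def)
  have sub: "?I \<subseteq> vertex_pairs n" "star K v \<subseteq> vertex_pairs n" "star K w \<subseteq> vertex_pairs n"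
    using assms inner_pairs_subset star_subset by auto
  have cI: "card ?I = j choose 2" using card_inner_pairs[OF fin] assms(2) by simp
  have cS: "card (?I \<union> star K x) = (j choose 2) + j" if "x \<in> {1..n} - K" for x
  proof -
    have "x \<notin> K" using that by auto
    then have "?I \<inter> star K x = {}" by (auto simp: inner_pairs_def star_def)
    then show ?thesis
      using fin fins assms(2) by (simp add: card_Un_disjoint finite_inner_pairs cI card_star)
  qed
  have e1: "?E (?ind ?I) = ?c" using expectation_avoids[OF sub(1)] by (simp only: cI)
  have e2: "?E (?ind (?I \<union> star K v)) = ?c * ?q" "?E (?ind (?I \<union> star K w)) = ?c * ?q"
    using sub assms(3,4) by (subst expectation_avoids; simp add: cS power_add)+
  have e3: "?E (?ind (?I \<union> star K v \<union> star K w)) = (if v = w then ?c * ?q else ?c * ?q * ?q)"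
  proof (cases "v = w")
    case True
    then show ?thesis using e2 by (simp add: Un_assoc)
  next
    case False
    have "(?I \<union> star K v) \<inter> star K w = {}"
      using star_disjoint[of v K w] star_disjoint[of w K v] assms False by auto
    then have "card (?I \<union> star K v \<union> star K w) = (j choose 2) + j + j"
      using fin fins assms(2) cS[OF assms(3)] by (simp add: card_Un_disjoint finite_inner_pairs card_star)
    then show ?thesis using sub False by (subst expectation_avoids) (auto simp: power_add)
  qed
  have "?E (\<lambda>E. ?ind ?I E * ((?ind (star K v) E - ?q) * (?ind (star K w) E - ?q)))
    = ?E (\<lambda>E. ?ind (?I \<union> star K v \<union> star K w) E - ?q * ?ind (?I \<union> star K v) E
         - ?q * ?ind (?I \<union> star K w) E + ?q * ?q * ?ind ?I E)"
    by (intro Bochner_Integration.integral_cong refl) (simp add: indicator_avoids_mult[symmetric] algebra_simps)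
  also have "\<dots> = ?E (?ind (?I \<union> star K v \<union> star K w)) - ?q * ?E (?ind (?I \<union> star K v))
         - ?q * ?E (?ind (?I \<union> star K w)) + ?q * ?q * ?E (?ind ?I)"
    by (simp only: Bochner_Integration.integral_add Bochner_Integration.integral_diff
       integral_mult_right_zero integrable_erdos_renyi)
  also have "\<dots> = (if v = w then ?c * ?q - ?q * ?q * ?c else 0)"
    unfolding e1 e2 e3 by (simp add: algebra_simps)
  also have "\<dots> \<le> (if v = w then ?c * ?q else 0)" by simp
  finally show ?thesis .
qed

lemma expectation_num_indep:
  "measure_pmf.expectation (erdos_renyi n (1/2)) (\<lambda>E. real (num_indep n E j)) = num_indep_mean n j"
proof -
  let ?E = "measure_pmf.expectation (erdos_renyi n (1/2))"
  let ?Ks = "{K. K \<subseteq> {1..n} \<and> card K = j}"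
  have "?E (\<lambda>E. real (num_indep n E j)) = ?E (\<lambda>E. \<Sum>K\<in>?Ks. indicator (avoids (inner_pairs K)) E)"
    by (intro integral_cong_AE AE_pmfI real_num_indep) (use set_pmf_erdos_renyi in auto)
  also have "\<dots> = (\<Sum>K\<in>?Ks. ?E (indicator (avoids (inner_pairs K))))"
    by (intro Bochner_Integration.integral_sum) simp
  also have "\<dots> = (\<Sum>K\<in>?Ks. (1/2) ^ (j choose 2))"
  proof (intro sum.cong refl)
    fix K assume K: "K \<in> ?Ks"
    then have "finite K" using finite_subset by blast
    then show "?E (indicat_real (avoids (inner_pairs K))) = (1/2) ^ (j choose 2)"
      using K by (subst expectation_avoids) (auto simp: inner_pairs_subset card_inner_pairs simp del: One_nat_def)
  qed
  also have "\<dots> = num_indep_mean n j"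
    using n_subsets[of "{1..n}" j] by (simp add: num_indep_mean_def)
  finally show ?thesis .
qed

text \<open>For each \<open>K\<close>, the second moment on the event of independence is at most
  \<open>ext_mean n j\<close> times the probability of that event. The mean absolute deviation is
  then at most the corresponding standard deviation.\<close>

lemma expectation_ext_deviation:
  assumes "j < n"
  shows "measure_pmf.expectation (erdos_renyi n (1/2)) (\<lambda>E. ext_deviation n E j)
    \<le> num_indep_mean n j * sqrt (ext_mean n j)"
proof -
  let ?E = "measure_pmf.expectation (erdos_renyi n (1/2))"
  let ?Ks = "{K. K \<subseteq> {1..n} \<and> card K = j}"
  let ?X = "\<lambda>K E v. indicator (avoids (star K v)) E - (1/2) ^ j :: real"
  let ?I = "\<lambda>K E. indicator (avoids (inner_pairs K)) E :: real"
  let ?c = "(1/2 :: real) ^ (j choose 2)"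
  define s where "s = sqrt (ext_mean n j)"
  have s: "s > 0" "s\<^sup>2 = ext_mean n j" using assms by (simp_all add: s_def ext_mean_def)
  have "?E (\<lambda>E. ext_deviation n E j) = ?E (\<lambda>E. \<Sum>K\<in>?Ks. ?I K E * \<bar>\<Sum>v\<in>{1..n} - K. ?X K E v\<bar>)"
    by (intro integral_cong_AE AE_pmfI ext_deviation_eq) (use set_pmf_erdos_renyi in auto)
  also have "\<dots> = (\<Sum>K\<in>?Ks. ?E (\<lambda>E. ?I K E * \<bar>\<Sum>v\<in>{1..n} - K. ?X K E v\<bar>))"
    by (intro Bochner_Integration.integral_sum) simp
  also have "\<dots> \<le> (\<Sum>K\<in>?Ks. ?c * s)"
  proof (intro sum_mono)
    fix K assume K: "K \<in> ?Ks"
    then have fin: "finite K" using finite_subset by blast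
    \<comment> \<open>This replaces Cauchy-Schwarz by a bound linear in the second moment; with
      \<open>s\<close> the square root of the variance bound nothing is lost.\<close>
    have amgm: "\<bar>x\<bar> \<le> x\<^sup>2 / (2 * s) + s / 2" for x :: real
    proof -
      have "0 \<le> (\<bar>x\<bar> - s)\<^sup>2" by simp
      then have "\<bar>x\<bar> * (2 * s) \<le> x\<^sup>2 + s\<^sup>2" by (simp add: power2_diff)
      then show ?thesis using s(1) by (simp add: field_simps power2_eq_square)
    qed
    have "?E (\<lambda>E. ?I K E * \<bar>\<Sum>v\<in>{1..n} - K. ?X K E v\<bar>)
       \<le> ?E (\<lambda>E. ?I K E * ((\<Sum>v\<in>{1..n} - K. ?X K E v)\<^sup>2 / (2 * s) + s / 2))"
      by (intro integral_mono mult_left_mono amgm) auto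
    also have "\<dots> = ?E (\<lambda>E. (\<Sum>v\<in>{1..n} - K. \<Sum>w\<in>{1..n} - K. ?I K E * (?X K E v * ?X K E w)) / (2 * s) + s / 2 * ?I K E)"
      unfolding power2_eq_square sum_product sum_distrib_left[symmetric]
      by (intro Bochner_Integration.integral_cong refl) (simp add: algebra_simps)
    also have "\<dots> = (\<Sum>v\<in>{1..n} - K. \<Sum>w\<in>{1..n} - K. ?E (\<lambda>E. ?I K E * (?X K E v * ?X K E w))) / (2 * s) + s / 2 * ?E (?I K)"
      by (simp only: Bochner_Integration.integral_add integral_divide_zero
       integral_mult_right_zero integrable_erdos_renyi Bochner_Integration.integral_sum)
    also have "?E (?I K) = ?c"
      using K fin by (subst expectation_avoids) (auto simp: inner_pairs_subset card_inner_pairs simp del: One_nat_def)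
    also have "(\<Sum>v\<in>{1..n} - K. \<Sum>w\<in>{1..n} - K. ?E (\<lambda>E. ?I K E * (?X K E v * ?X K E w)))
       \<le> (\<Sum>v\<in>{1..n} - K. \<Sum>w\<in>{1..n} - K. if v = w then ?c * (1/2) ^ j else 0)"
      using K by (intro sum_mono expectation_star_product) auto
    also have "\<dots> = real (card ({1..n} - K)) * (?c * (1/2) ^ j)"
      by simp
    also have "\<dots> = ?c * s\<^sup>2"
      using K fin by (simp add: s card_Diff_subset ext_mean_def power_divide del: One_nat_def)
    also have "?c * s\<^sup>2 / (2 * s) + s / 2 * ?c = ?c * s"
      using s(1) by (simp add: power2_eq_square)
    finally show "?E (\<lambda>E. ?I K E * \<bar>\<Sum>v\<in>{1..n} - K. ?X K E v\<bar>) \<le> ?c * s"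
      using s(1) by (simp add: divide_right_mono)
  qed
  also have "\<dots> = num_indep_mean n j * s"
    using n_subsets[of "{1..n}" j] by (simp add: num_indep_mean_def)
  finally show ?thesis by (simp add: s_def)
qed

text \<open>Each normalizer is the expected sum of the extension counts at level \<open>j\<close>,
  so the terms are relative deviations.\<close>

definition total_deviation :: "nat \<Rightarrow> nat set set \<Rightarrow> nat \<Rightarrow> real" where
  "total_deviation n E m = (\<Sum>j<m. ext_deviation n E j / (ext_mean n j * num_indep_mean n j))"

text \<open>The weight \<open>s - m\<close> makes one quantity control both the probability of sizes
  above \<open>m\<close> and their contribution to the mean size.\<close>

definition upper_excess :: "nat \<Rightarrow> nat set set \<Rightarrow> nat \<Rightarrow> real" where
  "upper_excess n E m = (\<Sum>s\<in>{m<..n}. real (s - m) * real (num_indep n E s)) / num_indep_mean n m"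

section \<open>Consequences of small deviations for a fixed graph\<close>

lemma ext_mean_pos: "j < n \<Longrightarrow> 0 < ext_mean n j"
  by (simp add: ext_mean_def)

lemma ext_mean_nonneg: "0 \<le> ext_mean n j"
  by (simp add: ext_mean_def)

lemma num_indep_mean_nonneg: "0 \<le> num_indep_mean n j"
  by (simp add: num_indep_mean_def)

lemma ext_deviation_nonneg: "0 \<le> ext_deviation n E j"
  by (simp add: ext_deviation_def sum_nonneg)

lemma total_deviation_nonneg: "0 \<le> total_deviation n E m"
  by (simp add: total_deviation_def sum_nonneg ext_deviation_nonneg ext_mean_nonneg num_indep_mean_nonneg)

lemma upper_excess_nonneg: "0 \<le> upper_excess n E m"
  unfolding upper_excess_def
  by (intro divide_nonneg_nonneg sum_nonneg mult_nonneg_nonneg num_indep_mean_nonneg) auto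

lemma total_deviation_mono: "j \<le> m \<Longrightarrow> total_deviation n E j \<le> total_deviation n E m"
  unfolding total_deviation_def
  by (intro sum_mono2) (auto simp: ext_deviation_nonneg ext_mean_nonneg num_indep_mean_nonneg)

lemma num_indep_Suc_diff_le:
  "\<bar>real (Suc j) * real (num_indep n E (Suc j)) - ext_mean n j * real (num_indep n E j)\<bar>
    \<le> ext_deviation n E j"
proof -
  have "real (Suc j) * real (num_indep n E (Suc j)) - ext_mean n j * real (num_indep n E j)
     = real (\<Sum>K\<in>indep_sets n E j. card (extensions n E K)) - ext_mean n j * real (num_indep n E j)"
    by (simp only: sum_card_extensions of_nat_mult)
  also have "\<dots> = (\<Sum>K\<in>indep_sets n E j. real (card (extensions n E K)) - ext_mean n j)"
    by (simp add: sum_subtractf num_indep_def mult.commute)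
  finally show ?thesis
    unfolding ext_deviation_def by (simp only: sum_abs)
qed

text \<open>The ratio of actual to expected count is 1 at \<open>j = 0\<close> and changes at each
  level by at most the relative deviation there.\<close>

lemma num_indep_ratio:
  "j \<le> n \<Longrightarrow> \<bar>real (num_indep n E j) / num_indep_mean n j - 1\<bar> \<le> total_deviation n E j"
proof (induction j)
  case (Suc j)
  let ?z = "\<lambda>j. real (num_indep n E j)" and ?\<mu> = "num_indep_mean n" and ?\<nu> = "ext_mean n j"
  have pos: "0 < ?\<mu> j" "0 < ?\<mu> (Suc j)" "0 < ?\<nu>"
    using Suc.prems by (auto intro: num_indep_mean_pos ext_mean_pos)
  have "?z (Suc j) / ?\<mu> (Suc j) = (real (Suc j) * ?z (Suc j)) / (real (Suc j) * ?\<mu> (Suc j))"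
    by (simp del: of_nat_Suc)
  also have "\<dots> = (real (Suc j) * ?z (Suc j)) / (?\<nu> * ?\<mu> j)"
    by (simp only: num_indep_mean_Suc)
  finally have "?z (Suc j) / ?\<mu> (Suc j) - ?z j / ?\<mu> j
      = (real (Suc j) * ?z (Suc j) - ?\<nu> * ?z j) / (?\<nu> * ?\<mu> j)"
    using pos by (simp add: diff_divide_distrib del: of_nat_Suc)
  also have "\<bar>\<dots>\<bar> \<le> ext_deviation n E j / (?\<nu> * ?\<mu> j)"
    using pos num_indep_Suc_diff_le[of j n E] by (simp add: abs_mult divide_right_mono del: of_nat_Suc)
  finally have "\<bar>?z (Suc j) / ?\<mu> (Suc j) - ?z j / ?\<mu> j\<bar> \<le> ext_deviation n E j / (?\<nu> * ?\<mu> j)" .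
  moreover have "total_deviation n E (Suc j) = total_deviation n E j + ext_deviation n E j / (?\<nu> * ?\<mu> j)"
    by (simp add: total_deviation_def)
  ultimately show ?case using Suc by linarith
qed (simp add: total_deviation_def)

lemma num_indep_bounds:
  assumes "j \<le> m" "m \<le> n" "total_deviation n E m \<le> 1/2"
  shows "num_indep_mean n j / 2 \<le> real (num_indep n E j)"
    "real (num_indep n E j) \<le> 3/2 * num_indep_mean n j" "0 < num_indep n E j"
proof -
  have pos: "0 < num_indep_mean n j" using assms by (intro num_indep_mean_pos) auto
  have "\<bar>real (num_indep n E j) / num_indep_mean n j - 1\<bar> \<le> 1/2"
    using num_indep_ratio[of j n E] total_deviation_mono[OF assms(1), of n E] assms by linarith
  then have "1/2 \<le> real (num_indep n E j) / num_indep_mean n j"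
     "real (num_indep n E j) / num_indep_mean n j \<le> 3/2" by linarith+
  with pos show *: "num_indep_mean n j / 2 \<le> real (num_indep n E j)"
    "real (num_indep n E j) \<le> 3/2 * num_indep_mean n j" by (simp_all add: field_simps)
  from * pos show "0 < num_indep n E j" by linarith
qed

text \<open>The constant 4 has two factors of 2: recentring at \<open>ext_mean\<close> costs as much
  again as the deviation itself, and the actual denominator is at least half of its
  expectation.\<close>

lemma irregularity_le:
  assumes "j < m" "m \<le> n" "total_deviation n E m \<le> 1/2"
  shows "irregularity n E j \<le> 4 * (ext_deviation n E j / (ext_mean n j * num_indep_mean n j))"
proof -
  let ?z = "\<lambda>j. real (num_indep n E j)" and ?\<mu> = "num_indep_mean n" and ?\<nu> = "ext_mean n j"
  have j: "Suc j \<le> m" "j \<le> m" "j < n" using assms by auto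
  have pos: "0 < ?\<mu> j" "0 < ?\<mu> (Suc j)" "0 < ?\<nu>"
    using j assms by (auto intro: num_indep_mean_pos ext_mean_pos)
  have z: "0 < ?z j" "0 < ?z (Suc j)"
    using num_indep_bounds(3)[OF j(1) assms(2,3)] num_indep_bounds(3)[OF j(2) assms(2,3)] by simp_all
  have "(\<Sum>K\<in>indep_sets n E j. \<bar>real (card (extensions n E K)) - mean_ext n E j\<bar>)
    \<le> (\<Sum>K\<in>indep_sets n E j. \<bar>real (card (extensions n E K)) - ?\<nu>\<bar> + \<bar>mean_ext n E j - ?\<nu>\<bar>)"
    by (intro sum_mono) linarith
  also have "\<dots> = ext_deviation n E j + ?z j * \<bar>mean_ext n E j - ?\<nu>\<bar>"
    by (simp add: sum.distrib ext_deviation_def num_indep_def)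
  also have "?z j * \<bar>mean_ext n E j - ?\<nu>\<bar> = \<bar>?z j * mean_ext n E j - ?z j * ?\<nu>\<bar>"
    by (simp add: abs_mult flip: right_diff_distrib)
  also have "?z j * mean_ext n E j = real (Suc j) * ?z (Suc j)"
    using z by (simp add: mean_ext_def del: of_nat_Suc mult_Suc)
  also have "\<bar>real (Suc j) * ?z (Suc j) - ?z j * ?\<nu>\<bar> \<le> ext_deviation n E j"
    using num_indep_Suc_diff_le[of j n E] by (simp only: mult.commute)
  finally have "irregularity n E j \<le> (2 * ext_deviation n E j) / real (Suc j * num_indep n E (Suc j))"
    unfolding irregularity_def by (intro divide_right_mono) auto
  also have "\<dots> \<le> (2 * ext_deviation n E j) / (?\<nu> * ?\<mu> j / 2)"
  proof (rule divide_left_mono)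
    have "?\<nu> * ?\<mu> j / 2 = real (Suc j) * (?\<mu> (Suc j) / 2)"
      using num_indep_mean_Suc[of j n] by simp
    also have "\<dots> \<le> real (Suc j) * ?z (Suc j)"
      using num_indep_bounds(1)[OF j(1) assms(2,3)] by (intro mult_left_mono) auto
    finally show "?\<nu> * ?\<mu> j / 2 \<le> real (Suc j * num_indep n E (Suc j))" by (simp only: of_nat_mult)
  qed (use pos z in \<open>simp_all add: ext_deviation_nonneg del: of_nat_Suc mult_Suc\<close>)
  finally show ?thesis by simp
qed

lemma sum_irregularity_le:
  assumes "m \<le> n" "total_deviation n E m \<le> 1/2"
  shows "(\<Sum>j<m. irregularity n E j) \<le> 4 * total_deviation n E m"
  unfolding total_deviation_def sum_distrib_left
  using assms by (intro sum_mono irregularity_le) auto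

text \<open>The constant 12 is made of 2 from the rate, 2 from \<open>n - j\<close> being at least
  \<open>n / 2\<close>, and 3 from the quotient of the bounds \<open>3/2\<close> and
  \<open>1/2\<close> on the counts.\<close>

lemma inverse_level_rate_le:
  assumes "j < m" "2 * m \<le> n" "total_deviation n E m \<le> 1/2"
  shows "1 / level_rate n E j \<le> 12 * 2 ^ j"
proof -
  let ?z = "\<lambda>j. real (num_indep n E j)" and ?\<mu> = "num_indep_mean n" and ?\<nu> = "ext_mean n j"
  have j: "Suc j \<le> m" "j \<le> m" "j < n" "m \<le> n" "0 < n" using assms by auto
  have pos: "0 < ?\<mu> j" "0 < ?\<nu>"
    using j assms by (auto intro: num_indep_mean_pos ext_mean_pos)
  have z: "0 < ?z j"
    using num_indep_bounds(3)[OF j(2,4) assms(3)] by simp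
  have "n / 2 \<le> real (n - j)" using assms j by linarith
  then have "n / (2 * 2 ^ j) \<le> ?\<nu>"
    by (simp add: ext_mean_def field_simps)
  also have "?\<nu> * (?\<mu> j / 2) = real (Suc j) * (?\<mu> (Suc j) / 2)"
    using num_indep_mean_Suc[of j n] by simp
  then have "?\<nu> = real (Suc j) * (?\<mu> (Suc j) / 2) / (?\<mu> j / 2)"
    using pos by (simp add: field_simps)
  also have "\<dots> \<le> real (Suc j) * ?z (Suc j) / (?z j / 3)"
    by (rule frac_le)
      (use num_indep_bounds(1)[OF j(1,4) assms(3)] num_indep_bounds(2)[OF j(2,4) assms(3)] z
       in \<open>auto intro: mult_left_mono\<close>)
  also have "\<dots> = 3 * mean_ext n E j" by (simp add: mean_ext_def del: of_nat_Suc mult_Suc)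
  finally have "1 / (12 * 2 ^ j) \<le> level_rate n E j"
    using j by (simp add: level_rate_def field_simps)
  then have rate: "1 \<le> level_rate n E j * (12 * 2 ^ j)"
    by (simp add: pos_divide_le_eq)
  then have "0 < level_rate n E j"
    by (smt (verit) mult_nonpos_nonneg zero_le_power)
  with rate show ?thesis
    by (simp add: pos_divide_le_eq mult.commute)
qed

text \<open>The waiting times grow geometrically, so reaching size \<open>k\<close> takes time of
  order \<open>2 ^ k\<close>. The logarithmic factor in the time bound is what makes missing it
  unlikely.\<close>

lemma sum_inverse_level_rate_le:
  assumes "k \<le> m" "2 * m \<le> n" "total_deviation n E m \<le> 1/2"
  shows "(\<Sum>j<k. 1 / level_rate n E j) \<le> 12 * 2 ^ k"
proof -
  have "(\<Sum>j<k. 1 / level_rate n E j) \<le> (\<Sum>j<k. 12 * 2 ^ j)"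
    using assms by (intro sum_mono inverse_level_rate_le) auto
  also have "\<dots> \<le> 12 * 2 ^ k"
    by (simp add: sum_gp_strict flip: sum_distrib_left)
  finally show ?thesis .
qed

text \<open>Consecutive ratios below \<open>k\<close> are at most a number which the last hypothesis
  bounds by 1. One factor is kept and the others are dropped.\<close>

lemma num_indep_mean_below:
  assumes "s < k" "2 * k \<le> n" "2 * real k * 2 ^ k \<le> real n"
  shows "num_indep_mean n s \<le> 2 * real k * 2 ^ k / real n * num_indep_mean n k"
proof -
  let ?x = "2 * real k * 2 ^ k / real n"
  have n: "n > 0" using assms by auto
  have x: "0 \<le> ?x" "?x \<le> 1" using assms n by auto
  have ratio: "num_indep_mean n s \<le> ?x * num_indep_mean n (Suc s)" if "s < k" for s
  proof -
    have nu: "0 < ext_mean n s" using that assms by (intro ext_mean_pos) auto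
    have "real (Suc s) \<le> ?x * ext_mean n s"
    proof -
      have "n / 2 \<le> real (n - s)" using that assms by linarith
      then have *: "n / (2 * 2 ^ s) \<le> ext_mean n s" by (simp add: ext_mean_def field_simps)
      have "real (Suc s) \<le> k" using that by simp
      also have "\<dots> \<le> real k * 2 ^ k / 2 ^ s"
        using that by (simp add: pos_le_divide_eq mult_left_mono)
      also have "\<dots> = ?x * (n / (2 * 2 ^ s))" using n by simp
      also have "\<dots> \<le> ?x * ext_mean n s" by (rule mult_left_mono[OF * x(1)])
      finally show ?thesis .
    qed
    then have "real (Suc s) * num_indep_mean n (Suc s) \<le> ?x * ext_mean n s * num_indep_mean n (Suc s)"
      by (intro mult_right_mono num_indep_mean_nonneg)
    then have "ext_mean n s * num_indep_mean n s \<le> ext_mean n s * (?x * num_indep_mean n (Suc s))"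
      unfolding num_indep_mean_Suc by (simp only: mult_ac)
    then show ?thesis using nu by (simp only: mult_le_cancel_left_pos)
  qed
  from assms(1) show ?thesis
  proof (induction rule: strict_inc_induct)
    case (base i)
    then show ?case using ratio[of i] by simp
  next
    case (step i)
    have "num_indep_mean n i \<le> ?x * num_indep_mean n (Suc i)" using step by (intro ratio) auto
    also have "\<dots> \<le> 1 * num_indep_mean n (Suc i)" by (intro mult_right_mono x num_indep_mean_nonneg)
    finally show ?case using step by simp
  qed
qed

text \<open>From \<open>m\<close> on, the ratio \<open>ext_mean n s / (s + 1)\<close> of consecutive
  means only decreases, which gives geometric decay.\<close>

lemma num_indep_mean_above:
  assumes "m \<le> s"
  shows "num_indep_mean n s \<le> (real n / (2 ^ m * real (Suc m))) ^ (s - m) * num_indep_mean n m"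
  using assms
proof (induction rule: dec_induct)
  case (step s)
  let ?r = "real n / (2 ^ m * real (Suc m))"
  have "real (Suc s) * num_indep_mean n (Suc s) = ext_mean n s * num_indep_mean n s"
    by (rule num_indep_mean_Suc)
  also have "\<dots> \<le> (real (Suc s) * ?r) * num_indep_mean n s"
  proof (intro mult_right_mono num_indep_mean_nonneg)
    have "ext_mean n s \<le> real n / 2 ^ m"
      unfolding ext_mean_def using step(1) by (intro frac_le) (auto intro: power_increasing)
    also have "\<dots> = real (Suc m) * ?r" by (simp del: of_nat_Suc)
    also have "\<dots> \<le> real (Suc s) * ?r" using step(1) by (intro mult_right_mono) auto
    finally show "ext_mean n s \<le> real (Suc s) * ?r" .
  qed
  finally have "num_indep_mean n (Suc s) \<le> ?r * num_indep_mean n s"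
    by (simp only: mult.assoc mult_le_cancel_left_pos of_nat_0_less_iff zero_less_Suc)
  also have "\<dots> \<le> ?r * (?r ^ (s - m) * num_indep_mean n m)"
    by (intro mult_left_mono step) auto
  finally show ?case using step(1) by (simp add: Suc_diff_le mult.assoc)
qed simp

lemma pmf_card_hardcore_le:
  "0 < num_indep n E i \<Longrightarrow> pmf (map_pmf card (hardcore n E)) s \<le> num_indep n E s / num_indep n E i"
  unfolding pmf_card_hardcore num_indep_def
  by (intro divide_left_mono) (auto intro!: card_mono mult_pos_pos simp: indep_sets_def card_gt_0_iff intro: finite_subset[OF _ finite_independent_sets])

lemma hardcore_upper_sum:
  assumes "m \<le> n" "total_deviation n E m \<le> 1/2"
  shows "(\<Sum>s\<in>{m<..n}. pmf (map_pmf card (hardcore n E)) s * real (s - m)) \<le> 2 * upper_excess n E m"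
proof -
  note z = num_indep_bounds[OF order.refl assms]
  have mu: "0 < num_indep_mean n m" using assms by (intro num_indep_mean_pos)
  have "(\<Sum>s\<in>{m<..n}. pmf (map_pmf card (hardcore n E)) s * real (s - m))
    \<le> (\<Sum>s\<in>{m<..n}. num_indep n E s / (num_indep_mean n m / 2) * real (s - m))"
  proof (intro sum_mono mult_right_mono)
    fix s
    have "pmf (map_pmf card (hardcore n E)) s \<le> num_indep n E s / num_indep n E m"
      using z(3) by (rule pmf_card_hardcore_le)
    also have "\<dots> \<le> num_indep n E s / (num_indep_mean n m / 2)"
      using z mu by (intro divide_left_mono) auto
    finally show "pmf (map_pmf card (hardcore n E)) s \<le> num_indep n E s / (num_indep_mean n m / 2)" .
  qed simp
  also have "\<dots> = 2 * upper_excess n E m"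
    unfolding upper_excess_def sum_divide_distrib sum_distrib_left by (intro sum.cong) auto
  finally show ?thesis .
qed

text \<open>A size \<open>s\<close> is at most \<open>m + (s - m)\<close>, where the truncated
  difference is the positive part.\<close>

lemma expectation_card_hardcore_le:
  assumes "m \<le> n" "total_deviation n E m \<le> 1/2"
  shows "measure_pmf.expectation (hardcore n E) (\<lambda>S. real (card S)) \<le> real m + 2 * upper_excess n E m"
proof -
  let ?w = "pmf (map_pmf card (hardcore n E))"
  have "measure_pmf.expectation (hardcore n E) (\<lambda>S. real (card S))
      = measure_pmf.expectation (map_pmf card (hardcore n E)) real" by simp
  also have "\<dots> = (\<Sum>s\<le>n. ?w s * real s)"
    by (subst integral_measure_pmf[of "{..n}"]) (use set_pmf_card_hardcore[of n E] in auto)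
  also have "\<dots> \<le> (\<Sum>s\<le>n. ?w s * real m + ?w s * real (s - m))"
    by (intro sum_mono) (simp add: mult_left_mono flip: distrib_left)
  also have "\<dots> = real m + (\<Sum>s\<le>n. ?w s * real (s - m))"
    using sum_pmf_eq_1[OF _ set_pmf_card_hardcore, of n E] by (simp add: sum.distrib flip: sum_distrib_right)
  also have "(\<Sum>s\<le>n. ?w s * real (s - m)) = (\<Sum>s\<in>{m<..n}. ?w s * real (s - m))"
    by (rule sum.mono_neutral_right) auto
  finally show ?thesis using hardcore_upper_sum[OF assms] by simp
qed

text \<open>Below the window each of the \<open>k\<close> sizes is compared with size
  \<open>k\<close>, the actual counts costing a factor 3; above it, \<open>s - m\<close> is at least
  1 and \<open>hardcore_upper_sum\<close> applies.\<close>

lemma prob_card_hardcore_outside_le: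
  assumes "k \<le> m" "2 * m \<le> n" "2 * real k * 2 ^ k \<le> real n" "total_deviation n E m \<le> 1/2"
  shows "measure_pmf.prob (hardcore n E) {S. card S \<notin> {k..m}}
    \<le> 6 * (real k)\<^sup>2 * 2 ^ k / real n + 2 * upper_excess n E m"
proof -
  let ?w = "pmf (map_pmf card (hardcore n E))"
  let ?x = "2 * real k * 2 ^ k / real n"
  have mn: "m \<le> n" using assms by simp
  note zk = num_indep_bounds[OF assms(1) mn assms(4)]
  have mu: "0 < num_indep_mean n k" using assms by (intro num_indep_mean_pos) auto
  have "measure_pmf.prob (hardcore n E) {S. card S \<notin> {k..m}}
     = measure_pmf.expectation (map_pmf card (hardcore n E)) (indicator (- {k..m}))"
    by (simp add: vimage_def)
  also have "\<dots> = (\<Sum>s\<le>n. ?w s * indicator (- {k..m}) s)"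
    by (subst integral_measure_pmf[of "{..n}"]) (use set_pmf_card_hardcore[of n E] in auto)
  also have "\<dots> = (\<Sum>s\<in>{..<k} \<union> {m<..n}. ?w s)"
    using assms by (intro sum.mono_neutral_cong_right) auto
  also have "\<dots> = (\<Sum>s<k. ?w s) + (\<Sum>s\<in>{m<..n}. ?w s)"
    using assms by (intro sum.union_disjoint) auto
  also have "(\<Sum>s\<in>{m<..n}. ?w s) \<le> (\<Sum>s\<in>{m<..n}. ?w s * real (s - m))"
    by (intro sum_mono) (simp add: mult_right_le_one_le mult_le_cancel_left1)
  also have "\<dots> \<le> 2 * upper_excess n E m"
    by (rule hardcore_upper_sum[OF mn assms(4)])
  also have "(\<Sum>s<k. ?w s) \<le> (\<Sum>s<k. 3 * ?x)"
  proof (intro sum_mono)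
    fix s assume s: "s \<in> {..<k}"
    have "?w s \<le> num_indep n E s / num_indep n E k"
      using zk(3) by (rule pmf_card_hardcore_le)
    also have "\<dots> \<le> (3/2 * num_indep_mean n s) / (num_indep_mean n k / 2)"
      using zk mu s num_indep_bounds(2)[of s m n E] assms mn num_indep_mean_nonneg by (intro frac_le) auto
    also have "\<dots> \<le> (3/2 * (?x * num_indep_mean n k)) / (num_indep_mean n k / 2)"
      using s assms mu num_indep_mean_below[of s k n] by (intro divide_right_mono mult_left_mono) auto
    also have "\<dots> = 3 * ?x" using mu by simp
    finally show "?w s \<le> 3 * ?x" .
  qed
  also have "(\<Sum>s<k. 3 * ?x) = 6 * (real k)\<^sup>2 * 2 ^ k / real n"
    by (simp add: power2_eq_square)
  finally show ?thesis by simp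
qed

section \<open>Expectations of the two error quantities\<close>

lemma expectation_total_deviation:
  assumes "2 * m \<le> n" "0 < n"
  shows "measure_pmf.expectation (erdos_renyi n (1/2)) (\<lambda>E. total_deviation n E m) \<le> 3 * sqrt (2 * 2 ^ m / n)"
proof -
  let ?E = "measure_pmf.expectation (erdos_renyi n (1/2))"
  have "?E (\<lambda>E. total_deviation n E m) = (\<Sum>j<m. ?E (\<lambda>E. ext_deviation n E j) / (ext_mean n j * num_indep_mean n j))"
    unfolding total_deviation_def by (subst Bochner_Integration.integral_sum) simp_all
  \<comment> \<open>The relative deviation at level \<open>j\<close> is on average at most
    \<open>ext_mean n j\<close> to the power -1/2. These bounds grow geometrically, so the last
    level dominates.\<close>
  also have "\<dots> \<le> (\<Sum>j<m. sqrt (2 * 2 ^ j / n))"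
  proof (intro sum_mono)
    fix j assume "j \<in> {..<m}"
    then have j: "j < m" "j < n" "j \<le> n" using assms by auto
    have pos: "0 < num_indep_mean n j" "0 < ext_mean n j"
      using j by (auto intro: num_indep_mean_pos ext_mean_pos)
    have "?E (\<lambda>E. ext_deviation n E j) / (ext_mean n j * num_indep_mean n j)
       \<le> num_indep_mean n j * sqrt (ext_mean n j) / (ext_mean n j * num_indep_mean n j)"
      using pos j by (intro divide_right_mono expectation_ext_deviation) auto
    also have "\<dots> = sqrt (ext_mean n j) / ext_mean n j"
      using pos by simp
    also have "\<dots> = sqrt (1 / ext_mean n j)"
      using pos real_div_sqrt[of "ext_mean n j"] by (simp add: real_sqrt_divide field_simps)
    also have "\<dots> \<le> sqrt (2 * 2 ^ j / n)"
    proof (rule real_sqrt_le_mono)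
      have "n / 2 \<le> real (n - j)" using j assms by linarith
      then have *: "n / (2 * 2 ^ j) \<le> ext_mean n j" by (simp add: ext_mean_def field_simps)
      have "1 / ext_mean n j \<le> 1 / (n / (2 * 2 ^ j))"
        using * pos assms by (intro divide_left_mono) auto
      then show "1 / ext_mean n j \<le> 2 * 2 ^ j / n" by simp
    qed
    finally show "?E (\<lambda>E. ext_deviation n E j) / (ext_mean n j * num_indep_mean n j) \<le> sqrt (2 * 2 ^ j / n)" .
  qed
  also have "\<dots> = (\<Sum>j<m. sqrt (2 ^ j)) * sqrt (2 / n)"
    unfolding sum_distrib_right real_sqrt_mult[symmetric] by (simp add: mult.commute)
  also have "\<dots> \<le> 3 * sqrt (2 ^ m) * sqrt (2 / n)"
  proof (rule mult_right_mono)
    show "(\<Sum>j<m. sqrt (2 ^ j)) \<le> 3 * sqrt (2 ^ m)"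
    proof (induction m)
      case (Suc m)
      \<comment> \<open>With constant 3 the induction step asks for
        \<open>3 + 1 \<le> 3 * sqrt 2\<close>.\<close>
      have "(4/3 :: real) \<le> sqrt 2" by (rule real_le_rsqrt) (simp add: power2_eq_square)
      then have "4 * sqrt (2 ^ m) \<le> 3 * sqrt 2 * sqrt (2 ^ m)" by (intro mult_right_mono) auto
      moreover have "sqrt (2 ^ Suc m) = sqrt 2 * sqrt (2 ^ m)" by (simp add: real_sqrt_mult)
      ultimately show ?case using Suc unfolding sum.lessThan_Suc by linarith
    qed simp
  qed simp
  also have "\<dots> = 3 * sqrt (2 * 2 ^ m / n)"
    unfolding mult.assoc real_sqrt_mult[symmetric] by (simp add: mult.commute)
  finally show ?thesis .
qed

text \<open>At \<open>r = 1/2\<close> the right-hand side is the exact value of the sum. The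
  subtracted remainder carries the induction; only the bound \<open>4 * r\<close> is used
  later.\<close>

lemma sum_mult_power_le:
  fixes r :: real
  assumes "0 \<le> r" "r \<le> 1/2"
  shows "(\<Sum>i\<le>N. real i * r ^ i) \<le> r * (4 - (2 * real N + 4) / 2 ^ N)"
proof (induction N)
  case (Suc N)
  have "r ^ N \<le> (1/2) ^ N" using assms by (intro power_mono)
  then have "real (Suc N) * r ^ Suc N \<le> real (Suc N) * (r * (1/2) ^ N)"
    using assms by (intro mult_left_mono) (auto intro: mult_left_mono)
  then have "(\<Sum>i\<le>Suc N. real i * r ^ i) \<le> r * (4 - (2 * real N + 4) / 2 ^ N) + real (Suc N) * (r * (1/2) ^ N)"
    using Suc unfolding sum.atMost_Suc by (rule add_mono[rotated])
  also have "\<dots> = r * (4 - (2 * real (Suc N) + 4) / 2 ^ Suc N)"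
    by (simp add: field_simps power_divide)
  finally show ?case .
qed simp

lemma expectation_upper_excess:
  assumes "m \<le> n" "real n / (2 ^ m * real (Suc m)) \<le> 1/2"
  shows "measure_pmf.expectation (erdos_renyi n (1/2)) (\<lambda>E. upper_excess n E m)
    \<le> 4 * (real n / (2 ^ m * real (Suc m)))"
proof -
  let ?E = "measure_pmf.expectation (erdos_renyi n (1/2))"
  let ?r = "real n / (2 ^ m * real (Suc m))"
  have r: "0 \<le> ?r" by simp
  have mu: "0 < num_indep_mean n m" using assms by (intro num_indep_mean_pos)
  have "?E (\<lambda>E. upper_excess n E m) = (\<Sum>s\<in>{m<..n}. real (s - m) * num_indep_mean n s) / num_indep_mean n m"
    unfolding upper_excess_def
    by (simp only: integral_divide_zero Bochner_Integration.integral_sum integrable_erdos_renyi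
       integral_mult_right_zero expectation_num_indep)
  also have "\<dots> = (\<Sum>s\<in>{m<..n}. real (s - m) * (num_indep_mean n s / num_indep_mean n m))"
    by (simp add: sum_divide_distrib)
  also have "\<dots> \<le> (\<Sum>s\<in>{m<..n}. real (s - m) * ?r ^ (s - m))"
  proof (intro sum_mono mult_left_mono)
    fix s assume "s \<in> {m<..n}"
    then show "num_indep_mean n s / num_indep_mean n m \<le> ?r ^ (s - m)"
      using num_indep_mean_above[of m s n] mu by (simp add: pos_divide_le_eq del: of_nat_Suc)
  qed simp
  also have "\<dots> = (\<Sum>i\<in>{0<..n - m}. real i * ?r ^ i)"
    by (rule sum.reindex_bij_witness[of _ "\<lambda>i. i + m" "\<lambda>s. s - m"]) auto
  also have "\<dots> \<le> (\<Sum>i\<le>n - m. real i * ?r ^ i)"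
    using r by (intro sum_mono2) auto
  also have "\<dots> \<le> ?r * (4 - (2 * real (n - m) + 4) / 2 ^ (n - m))"
    by (rule sum_mult_power_le[OF r assms(2)])
  also have "\<dots> \<le> ?r * 4"
    using r by (intro mult_left_mono) auto
  finally show ?thesis by (simp only: mult.commute)
qed

lemma erdos_renyi_Markov:
  assumes "\<And>E. 0 \<le> f E" "0 < c"
  shows "measure_pmf.prob (erdos_renyi n p) {E. f E > c} \<le> measure_pmf.expectation (erdos_renyi n p) f / c"
proof -
  have "measure_pmf.prob (erdos_renyi n p) {E. f E > c} \<le> measure_pmf.prob (erdos_renyi n p) {E. f E \<ge> c}"
    by (intro measure_pmf.finite_measure_mono) auto
  also have "\<dots> = measure_pmf.expectation (erdos_renyi n p) (indicator {E. f E \<ge> c})"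
    by simp
  also have "\<dots> \<le> measure_pmf.expectation (erdos_renyi n p) (\<lambda>E. f E / c)"
    using assms by (intro integral_mono) (auto simp: indicator_def)
  finally show ?thesis by simp
qed

lemma prob_good_graph:
  fixes \<delta> \<rho> :: real
  assumes "2 * m \<le> n" "0 < n" "real n / (2 ^ m * real (Suc m)) \<le> 1/2" "0 < \<delta>" "0 < \<rho>"
  shows "1 - 3 * sqrt (2 * 2 ^ m / n) / \<delta> - 4 * (real n / (2 ^ m * real (Suc m))) / \<rho>
    \<le> measure_pmf.prob (erdos_renyi n (1/2)) {E. total_deviation n E m \<le> \<delta> \<and> upper_excess n E m \<le> \<rho>}"
proof -
  let ?p = "erdos_renyi n (1/2)"
  let ?A = "{E. total_deviation n E m > \<delta>}" and ?B = "{E. upper_excess n E m > \<rho>}"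
  have "measure_pmf.prob ?p {E. total_deviation n E m \<le> \<delta> \<and> upper_excess n E m \<le> \<rho>}
     = 1 - measure_pmf.prob ?p (?A \<union> ?B)"
    by (subst measure_pmf.prob_compl[symmetric]) (auto intro!: arg_cong[where f = "measure_pmf.prob ?p"])
  moreover have "measure_pmf.prob ?p (?A \<union> ?B) \<le> measure_pmf.prob ?p ?A + measure_pmf.prob ?p ?B"
    by (intro measure_Un_le) auto
  moreover have "measure_pmf.prob ?p ?A \<le> 3 * sqrt (2 * 2 ^ m / n) / \<delta>"
    using assms by (intro order.trans[OF erdos_renyi_Markov] divide_right_mono
      expectation_total_deviation total_deviation_nonneg) simp_all
  moreover have "measure_pmf.prob ?p ?B \<le> 4 * (real n / (2 ^ m * real (Suc m))) / \<rho>"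
    using assms by (intro order.trans[OF erdos_renyi_Markov] divide_right_mono
      expectation_upper_excess upper_excess_nonneg) simp_all
  ultimately show ?thesis by linarith
qed

text \<open>Nothing is random in the graph any more. The coefficients are 24 = 2 * 12 from the
  waiting times, and 18 = 3 * 6 and 6 = 3 * 2 from the threefold outside probability.\<close>

lemma w2_good_graph:
  fixes \<delta> \<rho> D :: real and n k :: nat
  defines "T \<equiv> glauber_time n k"
  assumes "n > 0" "0 < k" "k \<le> m" "2 * m \<le> n" "2 * real k * 2 ^ k \<le> real n" "T > 0"
  assumes good: "total_deviation n E m \<le> \<delta>" "upper_excess n E m \<le> \<rho>" "\<delta> \<le> 1/2"
  assumes D: "4 * \<delta> + 2 * real k * real T / real n + 24 * 2 ^ k / real T
     + 18 * (real k)\<^sup>2 * 2 ^ k / real n + 6 * \<rho> \<le> D" and "D < 1"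
  shows "w2 n (subset_law n (hardcore n E)) (subset_law n (glauber_stopped n E k))
    \<le> sqrt (2 - 2 * (1 - D) * sqrt (real k / (real m + 2 * \<rho>)))"
  unfolding T_def
proof (rule w2_hardcore_glauber_le[where m = m])
  have dev: "total_deviation n E m \<le> 1/2" "m \<le> n" using good \<open>2 * m \<le> n\<close> by simp_all
  show "0 < num_indep n E j" if "j \<le> m" for j
    using that dev by (intro num_indep_bounds(3)) auto
  show "0 < glauber_time n k" using \<open>T > 0\<close> by (simp add: T_def)
  have "(\<Sum>i<k. 1 / level_rate n E i) \<le> 12 * 2 ^ k"
    by (rule sum_inverse_level_rate_le[OF assms(4,5) dev(1)])
  then have "2 * (\<Sum>i<k. 1 / level_rate n E i) / real T \<le> 24 * 2 ^ k / real T"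
    by (intro divide_right_mono) auto
  moreover have "(\<Sum>i<m. irregularity n E i) \<le> 4 * \<delta>"
    using sum_irregularity_le[OF dev(2,1)] good by linarith
  moreover have "3 * measure_pmf.prob (hardcore n E) {S. card S \<notin> {k..m}}
     \<le> 18 * (real k)\<^sup>2 * 2 ^ k / real n + 6 * \<rho>"
    using prob_card_hardcore_outside_le[OF assms(4,5,6) dev(1)] good by simp
  ultimately show "(\<Sum>i<m. irregularity n E i) + 2 * real k * real (glauber_time n k) / real n
     + 2 * (\<Sum>i<k. 1 / level_rate n E i) / real (glauber_time n k)
     + 3 * measure_pmf.prob (hardcore n E) {S. card S \<notin> {k..m}} \<le> D"
    using D unfolding T_def by linarith
  show "measure_pmf.expectation (hardcore n E) (\<lambda>S. real (card S)) \<le> real m + 2 * \<rho>"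
    using expectation_card_hardcore_le[OF dev(2,1)] good by linarith
qed (use \<open>n > 0\<close> \<open>0 < k\<close> \<open>k \<le> m\<close> \<open>D < 1\<close> in simp_all)

section \<open>Asymptotics\<close>

lemma two_powr_mult_log: "0 < L \<Longrightarrow> 2 powr (a * log 2 L) = L powr a"
  by (subst mult.commute) (simp add: powr_powr[symmetric])

text \<open>With \<open>2 ^ m\<close> of order \<open>n / sqrt L\<close>, extension counts below
  \<open>m\<close> are still large on average, whereas beyond \<open>m\<close> the expected counts
  decay at ratio of order \<open>1 / sqrt L\<close>. In terms of \<open>e\<close> the two
  expectations are of order \<open>e ^ 2\<close> and \<open>e ^ 4\<close>, which leaves room for
  Markov's inequality at thresholds of order \<open>e\<close>.\<close>

lemma good_parameters:
  fixes n k m T :: nat and L e :: real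
  defines "L \<equiv> log 2 (real n)"
  defines "e \<equiv> L powr (-1/8)"
  defines "k \<equiv> nat (round (L - 30 * log 2 L))"
  defines "m \<equiv> nat \<lfloor>L - log 2 L / 2\<rfloor>"
  defines "T \<equiv> glauber_time n k"
  assumes L: "2 \<le> L" "2 \<le> L - 30 * log 2 L" "2 * L \<le> n" and e: "e \<le> 1/601"
  shows "0 < n" "0 < k" "k \<le> m" "2 * m \<le> n" "2 * real k * 2 ^ k \<le> real n" "0 < T"
    and "L - 30 * log 2 L - 1 \<le> real k" "real m \<le> L"
    and "real n / (2 ^ m * real (Suc m)) \<le> 4 * e ^ 4" "sqrt (2 * 2 ^ m / n) \<le> sqrt 2 * e\<^sup>2"
    and "2 * real k * real T / real n + 24 * 2 ^ k / real T + 18 * (real k)\<^sup>2 * 2 ^ k / real n \<le> 441 * e"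
proof -
  have n: "real n > 0" using L by linarith
  then show "0 < n" by simp
  have e0: "0 < e" using L by (simp add: e_def)
  have logL: "1 \<le> log 2 L" using L(1) by (simp add: le_log_iff)
  have logL_le: "log 2 L \<le> L" using L logL by linarith
  have k0: "0 \<le> round (L - 30 * log 2 L)"
    using of_int_round_ge[of "L - 30 * log 2 L"] L(2) by linarith
  have k_le: "real k \<le> L - 30 * log 2 L + 1/2" and k_ge: "L - 30 * log 2 L - 1/2 \<le> real k"
    using of_int_round_ge[of "L - 30 * log 2 L"] of_int_round_le[of "L - 30 * log 2 L"] k0
    by (simp_all add: k_def)
  have kL: "real k \<le> L" using k_le logL by linarith
  show "0 < k" using k_ge L(2) by linarith
  show "L - 30 * log 2 L - 1 \<le> real k" using k_ge by linarith
  have m0: "0 \<le> \<lfloor>L - log 2 L / 2\<rfloor>" using L logL by simp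
  then have m_le: "real m \<le> L - log 2 L / 2" and m_ge: "L - log 2 L / 2 - 1 < real m"
    unfolding m_def by linarith+
  show "real m \<le> L" using m_le logL by linarith
  show "k \<le> m" using k_le m_ge logL by linarith
  show "2 * m \<le> n" using m_le logL L(3) by linarith
  have nL: "2 powr L = n" using n by (simp add: L_def)
  have Lpos: "0 < L" using L by simp
  \<comment> \<open>Rounding adds at most 1/2 to the exponent, absorbed into the factor 2.\<close>
  have two_k: "2 ^ k \<le> 2 * n / L ^ 30"
  proof -
    have "2 ^ k = 2 powr real k" by (simp add: powr_realpow)
    also have "\<dots> \<le> 2 powr (L - 30 * log 2 L + 1)" using k_le by (intro powr_mono) auto
    also have "\<dots> = 2 * n / L powr 30"
      using Lpos by (simp add: powr_add powr_diff nL two_powr_mult_log)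
    also have "L powr 30 = L ^ 30" using Lpos by (simp add: powr_numeral)
    finally show ?thesis .
  qed
  have Lpow: "L ^ a * (2 ^ k) / n \<le> 2 / L" if "a \<le> 29" for a
  proof -
    have "L ^ a * 2 ^ k \<le> L ^ 29 * (2 * n / L ^ 30)"
      using L that two_k by (intro mult_mono power_increasing) auto
    also have "\<dots> = 2 * n / L" using Lpos by (simp add: power_eq_if[of _ 30])
    finally show ?thesis using n by (simp add: pos_divide_le_eq)
  qed
  have "2 * real k * 2 ^ k \<le> 2 * L * 2 ^ k" using kL by simp
  also have "\<dots> \<le> L ^ 2 * 2 ^ k" using L(1) by (simp add: power2_eq_square)
  also have "\<dots> \<le> n * (2 / L)" using Lpow[of 2] n by (simp add: pos_divide_le_eq mult.commute)
  also have "\<dots> \<le> real n * 1" using L(1) by (intro mult_left_mono) auto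
  finally show "2 * real k * 2 ^ k \<le> real n" by simp
  have e8: "e ^ 8 = 1 / L"
  proof -
    have "e ^ 8 = L powr (-1/8 * real 8)" using Lpos unfolding e_def by (subst powr_power) auto
    then show ?thesis using Lpos by (simp add: powr_minus_divide)
  qed
  have Le: "1 / L \<le> e"
  proof -
    have "e ^ 8 \<le> e ^ 1" using e e0 by (intro power_decreasing) auto
    then show ?thesis using e8 by simp
  qed
  \<comment> \<open>The floor loses less than 1 in the exponent, hence the factor 2 between the
    bounds.\<close>
  have two_m: "2 ^ m \<le> n * e ^ 4" and two_m': "n * e ^ 4 / 2 \<le> 2 ^ m"
  proof -
    have "e ^ 4 = L powr (-1/8 * real 4)" using Lpos unfolding e_def by (subst powr_power) auto
    then have e4: "e ^ 4 = L powr (-1/2)" by simp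
    have *: "2 powr (L - log 2 L / 2) = n * e ^ 4"
      using Lpos two_powr_mult_log[of L "1/2"] unfolding e4 by (simp add: powr_diff nL powr_minus_divide)
    have "2 ^ m = 2 powr real m" by (simp add: powr_realpow)
    moreover have "2 powr real m \<le> 2 powr (L - log 2 L / 2)" using m_le by (intro powr_mono) auto
    moreover have "2 powr (L - log 2 L / 2 - 1) \<le> 2 powr real m" using m_ge by (intro powr_mono) auto
    moreover have "2 powr (L - log 2 L / 2 - 1) = n * e ^ 4 / 2"
      by (subst powr_diff) (simp add: *)
    ultimately show "2 ^ m \<le> n * e ^ 4" "n * e ^ 4 / 2 \<le> 2 ^ m" using * by simp_all
  qed
  have "L / 2 \<le> real (Suc m)" using m_ge logL_le by simp
  then have "(n * e ^ 4 / 2) * (L / 2) \<le> 2 ^ m * real (Suc m)"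
    using two_m' Lpos n e0 by (intro mult_mono) auto
  then have "real n / (2 ^ m * real (Suc m)) \<le> real n / ((n * e ^ 4 / 2) * (L / 2))"
    using n e0 Lpos by (intro divide_left_mono) auto
  also have "\<dots> = 4 * (1 / L) / e ^ 4" using n by simp
  also have "\<dots> = 4 * e ^ 8 / e ^ 4" by (simp only: e8)
  also have "\<dots> = 4 * e ^ 4" using e0 by (simp add: power_diff[symmetric] flip: times_divide_eq_right)
  finally show "real n / (2 ^ m * real (Suc m)) \<le> 4 * e ^ 4" .
  have "sqrt (2 * 2 ^ m / n) \<le> sqrt (2 * e ^ 4)"
    using two_m n by (intro real_sqrt_le_mono) (simp add: field_simps)
  also have "\<dots> = sqrt 2 * e\<^sup>2"
    using real_sqrt_abs[of "e\<^sup>2"] by (simp add: real_sqrt_mult flip: power_mult)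
  finally show "sqrt (2 * 2 ^ m / n) \<le> sqrt 2 * e\<^sup>2" .
  let ?t = "L * 2 ^ k"
  have t1: "1 \<le> ?t" using L(1) one_le_power[of "2::real" k] by (smt (verit) mult_le_cancel_right1)
  have T: "real T = of_int (round (100 * ?t))"
    using of_int_round_ge[of "100 * ?t"] t1
    by (simp add: T_def glauber_time_def L_def[symmetric] mult.assoc)
  \<comment> \<open>Rounding moves \<open>100 * ?t\<close> by at most 1/2, and \<open>?t\<close> is
    at least 1.\<close>
  have T_le: "real T \<le> 101 * ?t" and T_ge: "99 * ?t \<le> real T"
    using of_int_round_ge[of "100 * ?t"] of_int_round_le[of "100 * ?t"] t1 unfolding T by linarith+
  then show "0 < T" using t1 by linarith
  have "2 * real k * real T / real n \<le> 2 * L * (101 * ?t) / real n"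
    using kL T_le L n by (intro divide_right_mono mult_mono) auto
  also have "\<dots> = 202 * (L ^ 2 * 2 ^ k / n)" by (simp add: power2_eq_square)
  also have "\<dots> \<le> 202 * (2 / L)" using Lpow[of 2] by (intro mult_left_mono) auto
  finally have 1: "2 * real k * real T / real n \<le> 404 * (1 / L)" by simp
  have "24 * 2 ^ k / real T \<le> 24 * 2 ^ k / (99 * ?t)"
    using T_ge t1 by (intro divide_left_mono) auto
  also have "\<dots> = 24 / 99 * (1 / L)" using Lpos by simp
  also have "\<dots> \<le> 1 * (1 / L)" using Lpos by (intro mult_right_mono) auto
  finally have 2: "24 * 2 ^ k / real T \<le> 1 / L" by simp
  have "18 * (real k)\<^sup>2 * 2 ^ k / real n \<le> 18 * L\<^sup>2 * 2 ^ k / real n"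
    using kL n by (intro divide_right_mono mult_right_mono mult_left_mono power_mono) auto
  also have "\<dots> = 18 * (L\<^sup>2 * 2 ^ k / real n)" by simp
  also have "\<dots> \<le> 18 * (2 / L)" using Lpow[of 2] by (intro mult_left_mono) auto
  finally have 3: "18 * (real k)\<^sup>2 * 2 ^ k / real n \<le> 36 * (1 / L)" by simp
  \<comment> \<open>441 = 404 + 1 + 36.\<close>
  show "2 * real k * real T / real n + 24 * 2 ^ k / real T + 18 * (real k)\<^sup>2 * 2 ^ k / real n \<le> 441 * e"
    using 1 2 3 Le by linarith
qed

text \<open>The term \<open>2 * e\<close> covers the failure probability, and the square root is the
  distance bound of \<open>w2_good_graph\<close> with \<open>D = 600 * e\<close>. The denominator
  \<open>L + 1\<close> dominates the bound on the mean size.\<close>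

definition error_bound :: "nat \<Rightarrow> real" where
  "error_bound n = (let L = log 2 (real n); e = L powr (-1/8) in
     2 * e + sqrt (2 - 2 * (1 - 600 * e) * sqrt ((L - 30 * log 2 L - 1) / (L + 1))))"

lemma error_bound_tendsto_0: "error_bound \<longlonglongrightarrow> 0"
proof -
  have L: "filterlim (\<lambda>n. log 2 (real n)) at_top sequentially"
    by real_asymp
  have "((\<lambda>L. 2 * L powr (-1/8) + sqrt (2 - 2 * (1 - 600 * L powr (-1/8))
     * sqrt ((L - 30 * log 2 L - 1) / (L + 1)))) \<longlongrightarrow> 0) (at_top :: real filter)"
  proof -
    have e: "((\<lambda>L :: real. L powr (-1/8)) \<longlongrightarrow> 0) at_top" by real_asymp
    have q: "((\<lambda>L :: real. (L - 30 * log 2 L - 1) / (L + 1)) \<longlongrightarrow> 1) at_top" by real_asymp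
    have "((\<lambda>L. 2 * L powr (-1/8) + sqrt (2 - 2 * (1 - 600 * L powr (-1/8))
     * sqrt ((L - 30 * log 2 L - 1) / (L + 1)))) \<longlongrightarrow> 2 * 0 + sqrt (2 - 2 * (1 - 600 * 0) * sqrt 1)) (at_top :: real filter)"
      by (intro tendsto_intros e q)
    then show ?thesis by simp
  qed
  from filterlim_compose[OF this L] show ?thesis
    by (simp add: error_bound_def[abs_def] Let_def)
qed

theorem theorem1p3:
  "\<exists>\<epsilon> :: nat \<Rightarrow> real. \<epsilon> \<longlonglongrightarrow> 0 \<and>
     (\<forall>\<^sub>F n in sequentially.
        let k = nat (round (log 2 (real n) - 30 * log 2 (log 2 (real n)))) in
        measure_pmf.prob (erdos_renyi n (1/2))
          {E. w2 n (subset_law n (hardcore n E)) (subset_law n (glauber_stopped n E k)) \<le> \<epsilon> n}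
        \<ge> 1 - \<epsilon> n)"
proof (intro exI[of _ error_bound] conjI error_bound_tendsto_0)
  have "\<forall>\<^sub>F n :: nat in sequentially. 2 \<le> log 2 (real n)" by real_asymp
  moreover have "\<forall>\<^sub>F n :: nat in sequentially. 2 \<le> log 2 (real n) - 30 * log 2 (log 2 (real n))" by real_asymp
  moreover have "\<forall>\<^sub>F n :: nat in sequentially. 2 * log 2 (real n) \<le> real n" by real_asymp
  moreover have "\<forall>\<^sub>F n :: nat in sequentially. log 2 (real n) powr (-1/8) \<le> 1/601" by real_asymp
  ultimately show "\<forall>\<^sub>F n in sequentially.
        let k = nat (round (log 2 (real n) - 30 * log 2 (log 2 (real n)))) in
        measure_pmf.prob (erdos_renyi n (1/2))
          {E. w2 n (subset_law n (hardcore n E)) (subset_law n (glauber_stopped n E k)) \<le> error_bound n}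
        \<ge> 1 - error_bound n"
  proof eventually_elim
    case (elim n)
    define L where "L = log 2 (real n)"
    define e where "e = L powr (-1/8)"
    define k where "k = nat (round (L - 30 * log 2 L))"
    define m where "m = nat \<lfloor>L - log 2 L / 2\<rfloor>"
    note params = good_parameters[OF elim, folded L_def, folded e_def k_def m_def]
    have L: "2 \<le> L" "2 \<le> L - 30 * log 2 L" "e \<le> 1/601"
      using elim by (simp_all add: L_def e_def)
    have e0: "0 < e" using L by (simp add: e_def)
    define s where "s = sqrt (2 - 2 * (1 - 600 * e) * sqrt ((L - 30 * log 2 L - 1) / (L + 1)))"
    have err: "error_bound n = 2 * e + s"
      by (simp add: error_bound_def s_def e_def L_def Let_def)
    \<comment> \<open>The thresholds make each Markov bound at most \<open>e\<close>. They give a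
      total error of 20 + 441 + 96 = 557 multiples of \<open>e\<close>, below 600, and
      \<open>2 * (16 * e)\<close> is below 1 since \<open>e \<le> 1/601\<close>.\<close>
    let ?good = "{E. total_deviation n E m \<le> 5 * e \<and> upper_excess n E m \<le> 16 * e}"
    let ?r = "real n / (2 ^ m * real (Suc m))"
    have e4: "e ^ 4 \<le> e" "e ^ 3 \<le> e" "4 * e ^ 4 \<le> 1/2"
    proof -
      have "e ^ 4 \<le> e ^ 1" "e ^ 3 \<le> e ^ 1" using e0 L by (intro power_decreasing; simp)+
      then show "e ^ 4 \<le> e" "e ^ 3 \<le> e" "4 * e ^ 4 \<le> 1/2" using L by simp_all
    qed
    have w2: "w2 n (subset_law n (hardcore n E)) (subset_law n (glauber_stopped n E k)) \<le> s" if "E \<in> ?good" for E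
    proof -
      have "w2 n (subset_law n (hardcore n E)) (subset_law n (glauber_stopped n E k))
        \<le> sqrt (2 - 2 * (1 - 600 * e) * sqrt (real k / (real m + 2 * (16 * e))))"
        using that params L e0 by (intro w2_good_graph[where \<delta> = "5 * e"]) auto
      also have "\<dots> \<le> s"
        unfolding s_def
      proof (intro real_sqrt_le_mono diff_left_mono mult_left_mono)
        show "(L - 30 * log 2 L - 1) / (L + 1) \<le> real k / (real m + 2 * (16 * e))"
          using params L e0 by (intro frac_le) auto
      qed (use L in auto)
      finally show ?thesis .
    qed
    \<comment> \<open>The real \<open>sqrt\<close> is negative on negative arguments, so the
      radicand has to be checked; nonnegativity lets \<open>error_bound n\<close> dominate the
      failure probability \<open>2 * e\<close>.\<close>
    have "s \<ge> 0"
    proof -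
      have "0 \<le> log 2 L" using L by (simp add: le_log_iff)
      then have "L - 30 * log 2 L - 1 \<le> L + 1" by linarith
      then have "sqrt ((L - 30 * log 2 L - 1) / (L + 1)) \<le> 1" "0 \<le> sqrt ((L - 30 * log 2 L - 1) / (L + 1))"
        using L(1,2) by (simp_all only: real_sqrt_le_1_iff real_sqrt_ge_0_iff) (auto simp: divide_le_eq)
      then have "(1 - 600 * e) * sqrt ((L - 30 * log 2 L - 1) / (L + 1)) \<le> 1"
        using e0 L by (intro mult_le_one) auto
      then show ?thesis unfolding s_def real_sqrt_ge_0_iff mult.assoc by linarith
    qed
    have "1 - error_bound n \<le> 1 - e - e"
      using \<open>s \<ge> 0\<close> by (simp add: err)
    also have "\<dots> \<le> 1 - 3 * sqrt (2 * 2 ^ m / n) / (5 * e) - 4 * ?r / (16 * e)"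
    proof -
      have "3 * sqrt (2 * 2 ^ m / n) / (5 * e) \<le> 3 * (sqrt 2 * e\<^sup>2) / (5 * e)"
        using params(10) e0 by (intro divide_right_mono) auto
      also have "\<dots> = 3 * sqrt 2 / 5 * e" using e0 by (simp add: power2_eq_square)
      also have "\<dots> \<le> 1 * e"
      proof (rule mult_right_mono)
        have "sqrt 2 \<le> 5 / 3" by (rule real_le_lsqrt) (auto simp: power2_eq_square)
        then show "3 * sqrt 2 / 5 \<le> 1" by simp
      qed (use e0 in simp)
      finally have 1: "3 * sqrt (2 * 2 ^ m / n) / (5 * e) \<le> e" by simp
      have "4 * ?r / (16 * e) \<le> 4 * (4 * e ^ 4) / (16 * e)"
        using params(9) e0 by (intro divide_right_mono) auto
      also have "\<dots> = e ^ 3" using e0 by (simp add: power_eq_if[of _ 4])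
      finally have 2: "4 * ?r / (16 * e) \<le> e" using e4 by linarith
      from 1 2 show ?thesis by linarith
    qed
    also have "\<dots> \<le> measure_pmf.prob (erdos_renyi n (1/2)) ?good"
      using params e0 e4 by (intro prob_good_graph) linarith+
    also have "\<dots> \<le> measure_pmf.prob (erdos_renyi n (1/2))
       {E. w2 n (subset_law n (hardcore n E)) (subset_law n (glauber_stopped n E k)) \<le> error_bound n}"
      using w2 e0 by (intro measure_pmf.finite_measure_mono) (fastforce simp: err)+
    finally show ?case
      by (simp add: Let_def k_def L_def)
  qed
qed

end
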